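(* Let $X$ be a set and let $\mathscr{F}$ be a $\sigma$-algebra of subsets of $X$. Let $\{\mu_i\}_{i \ge 1}$ be a countable family of charges on $(X, \mathscr{F})$ such that $\mu_i \perp \mu_j$ (i.e. $\mu_i$ and $\mu_j$ are singular) for all $i \neq j$, and such that the sum $\mu = \sum_{i \ge 1} \mu_i$, $\mu(A) = \sum_{i\ge 1}\mu_i(A)$ for $A \in \mathscr{F}$, exists (as a bounded charge on $(X,\mathscr{F})$). Let $S_i = \operatorname{supp} \mu_i$ be the support of $\mu_i$ in the Stone space $F$ of $\mathscr{F}$. Then $\mu$ has the additive property if and only if all of the following hold: each $\mu_i$ has the additive property; $\mu_i$ and $\mu_j$ are strongly singular for all $i \ne j$; and $$\left(\limsup_i S_i\right) \cap \bigcup_{i \ge 1} S_i = \emptyset, \qquad \text{where } \limsup_i S_i = \bigcap_{i \ge 1} \overline{\bigcup_{j \ge i} S_j}$$ and the closure is taken in $F$.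
   Context: A charge on $(X, \mathscr{F})$, where $\mathscr{F}$ is a field (algebra) of subsets of $X$, is a function $\mu$ on $\mathscr{F}$ with $\mu(\emptyset) = 0$ and $\mu(A \cup B) = \mu(A) + \mu(B)$ whenever $A, B \in \mathscr{F}$ and $A \cap B = \emptyset$. Charges are always assumed nonnegative and bounded: $\mu(A) \ge 0$ for all $A \in \mathscr{F}$ and $\mu(X) < \infty$. Additive property: a charge $\mu$ on $(X,\mathscr{F})$ has the additive property if for every $\varepsilon > 0$ and every increasing sequence $A_1 \subseteq A_2 \subseteq \cdots$ in $\mathscr{F}$ there exists $B \in \mathscr{F}$ such that (1) $\mu(B) \le \lim_{i \to \infty} \mu(A_i) + \varepsilon$ and (2) $\mu(A_i \setminus B) = 0$ for every $i = 1, 2, \ldots$. Singular: charges $\mu, \nu$ on $(X, \mathscr{F})$ are singular, written $\mu \perp \nu$, if for every $\varepsilon > 0$ there exists $D \in \mathscr{F}$ with $\mu(D) < \varepsilon$ and $\nu(D^c) < \varepsilon$. Strongly singular: charges $\mu, \nu$ on $(X, \mathscr{F})$ are strongly singular if there exists $D \in \mathscr{F}$ with $\mu(D) = 0$ and $\nu(D^c) = 0$. Stone space and support: regard $\mathscr{F}$ as a Boolean algebra, let $F$ be its Stone space (a compact, totally disconnected Hausdorff space) and let $\phi : \mathscr{F} \to \mathscr{C}$ be the canonical Boolean isomorphism onto the algebra $\mathscr{C}$ of clopen subsets of $F$. For a charge $\mu$ on $(X, \mathscr{F})$, the set function $\hat\mu(\phi(A)) = \mu(A)$ on $\mathscr{C}$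 extends uniquely to a regular Borel measure on $F$, again denoted $\hat\mu$. The support $\operatorname{supp} \mu \subseteq F$ of $\mu$ is the (closed) support of the regular Borel measure $\hat\mu$. *)

theory Defs
  imports "HOL-Analysis.Analysis"
begin

(* Boundedness of a charge is implicit: its values are real numbers.
   Values of the function outside the field F are irrelevant. *)
definition charge :: "'a set \<Rightarrow> 'a set set \<Rightarrow> ('a set \<Rightarrow> real) \<Rightarrow> bool" where
  "charge X F \<mu> \<longleftrightarrow> algebra X F \<and> \<mu> {} = 0 \<and> additive F \<mu> \<and> (\<forall>A\<in>F. 0 \<le> \<mu> A)"

definition additive_property :: "'a set set \<Rightarrow> ('a set \<Rightarrow> real) \<Rightarrow> bool" where
  "additive_property F \<mu> \<longleftrightarrow>
     (\<forall>\<epsilon>>0. \<forall>A :: nat \<Rightarrow> 'a set. range A \<subseteq> F \<and> incseq A \<longrightarrow>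
        (\<exists>B\<in>F. \<mu> B \<le> lim (\<lambda>i. \<mu> (A i)) + \<epsilon> \<and> (\<forall>i. \<mu> (A i - B) = 0)))"

definition singular_charges ::
    "'a set \<Rightarrow> 'a set set \<Rightarrow> ('a set \<Rightarrow> real) \<Rightarrow> ('a set \<Rightarrow> real) \<Rightarrow> bool" where
  "singular_charges X F \<mu> \<nu> \<longleftrightarrow> (\<forall>\<epsilon>>0. \<exists>D\<in>F. \<mu> D < \<epsilon> \<and> \<nu> (X - D) < \<epsilon>)"

definition strongly_singular_charges ::
    "'a set \<Rightarrow> 'a set set \<Rightarrow> ('a set \<Rightarrow> real) \<Rightarrow> ('a set \<Rightarrow> real) \<Rightarrow> bool" where
  "strongly_singular_charges X F \<mu> \<nu> \<longleftrightarrow> (\<exists>D\<in>F. \<mu> D = 0 \<and> \<nu> (X - D) = 0)"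

definition ultrafilter_in :: "'a set \<Rightarrow> 'a set set \<Rightarrow> 'a set set \<Rightarrow> bool" where
  "ultrafilter_in X F p \<longleftrightarrow>
     p \<subseteq> F \<and> X \<in> p \<and> {} \<notin> p \<and>
     (\<forall>A\<in>p. \<forall>B\<in>p. A \<inter> B \<in> p) \<and>
     (\<forall>A\<in>p. \<forall>B\<in>F. A \<subseteq> B \<longrightarrow> B \<in> p) \<and>
     (\<forall>A\<in>F. A \<in> p \<or> X - A \<in> p)"

(* The canonical Boolean isomorphism from F onto the clopen subsets of the Stone space. *)
definition stone_map :: "'a set \<Rightarrow> 'a set set \<Rightarrow> 'a set \<Rightarrow> 'a set set set" where
  "stone_map X F A = {p. ultrafilter_in X F p \<and> A \<in> p}"

(* The underlying set is stone_map X F X, the set of all ultrafilters of F. *)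
definition stone_space :: "'a set \<Rightarrow> 'a set set \<Rightarrow> 'a set set topology" where
  "stone_space X F = topology_generated_by (stone_map X F ` F)"

definition regular_borel_measure :: "'b topology \<Rightarrow> 'b measure \<Rightarrow> bool" where
  "regular_borel_measure T M \<longleftrightarrow>
     sets M = sigma_sets (topspace T) {U. openin T U} \<and>
     finite_measure M \<and>
     (\<forall>E\<in>sets M. emeasure M E = (INF U\<in>{U. openin T U \<and> E \<subseteq> U}. emeasure M U) \<and>
                 emeasure M E = (SUP K\<in>{K. compactin T K \<and> K \<subseteq> E}. emeasure M K))"

(* The definite description is legitimate for charges: the extension exists and is unique. *)
definition stone_measure ::
    "'a set \<Rightarrow> 'a set set \<Rightarrow> ('a set \<Rightarrow> real) \<Rightarrow> 'a set set measure" where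
  "stone_measure X F \<mu> =
     (THE M. regular_borel_measure (stone_space X F) M \<and>
             (\<forall>A\<in>F. emeasure M (stone_map X F A) = ennreal (\<mu> A)))"

(* The closed support of a Borel measure: the complement of the union of all open null sets. *)
definition borel_support :: "'b topology \<Rightarrow> 'b measure \<Rightarrow> 'b set" where
  "borel_support T M = topspace T - \<Union>{U. openin T U \<and> emeasure M U = 0}"

definition charge_support :: "'a set \<Rightarrow> 'a set set \<Rightarrow> ('a set \<Rightarrow> real) \<Rightarrow> 'a set set set" where
  "charge_support X F \<mu> = borel_support (stone_space X F) (stone_measure X F \<mu>)"

(* The intersection over i of the closures of the tail unions; this is the limsup of the
   statement, not the set-theoretic one, which takes no closures. *)
definition closed_limsup :: "'b topology \<Rightarrow> (nat \<Rightarrow> 'b set) \<Rightarrow> 'b set" where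
  "closed_limsup T S = (\<Inter>i. T closure_of (\<Union>j\<in>{i..}. S j))"

end

theory Submission
  imports Defs
begin

text \<open>
  Both sides are equivalent to the following: every \<open>\<mu>\<^sub>i\<close> has the additive property and is carried
  by a set \<open>D\<^sub>i \<in> F\<close> that is null for all the other \<open>\<mu>\<^sub>j\<close>.

  If \<open>\<mu>\<close> has the additive property, then so does the sum of \<open>\<mu>\<^sub>i\<close> and the singular charge
  \<open>\<mu> - \<mu>\<^sub>i\<close>; a Borel--Cantelli type choice of separating sets followed by two applications of the
  additive property (with \<open>\<epsilon> = 0\<close>, which is possible over a \<open>\<sigma>\<close>-algebra) separates them exactly.
  Conversely, the \<open>D\<^sub>i\<close> can be made disjoint, and sets \<open>B\<^sub>i \<subseteq> D\<^sub>i\<close> that are good for \<open>\<mu>\<^sub>i\<close> are glued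
  to \<open>\<Union>\<^sub>i B\<^sub>i\<close>; no countable additivity is needed, since \<open>\<mu>\<^sub>i\<close> only sees the part inside \<open>D\<^sub>i\<close>.

  On the topological side, the support of a charge consists of the ultrafilters without null sets, and
  the closed limsup consists of the ultrafilters all of whose members are charged by infinitely many
  \<open>\<mu>\<^sub>j\<close>. By the ultrafilter theorem, the limsup misses \<open>S\<^sub>i\<close> if and only if \<open>\<mu>\<^sub>i\<close> is carried by a set
  that is charged by finitely many \<open>\<mu>\<^sub>j\<close> only. To identify the support, the regular Borel measure on
  the Stone space is constructed from the outer measure induced by the inner content of open sets.
\<close>

section \<open>Charges and the additive property\<close>

context
  fixes X :: "'a set" and F :: "'a set set" and \<mu> :: "'a set \<Rightarrow> real"
  assumes charge: "charge X F \<mu>"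
begin

interpretation algebra X F
  using charge by (simp add: charge_def)

lemma charge_empty: "\<mu> {} = 0"
  using charge by (simp add: charge_def)

lemma charge_nonneg: "A \<in> F \<Longrightarrow> 0 \<le> \<mu> A"
  using charge by (simp add: charge_def)

lemma charge_disjoint_Un: "A \<in> F \<Longrightarrow> B \<in> F \<Longrightarrow> A \<inter> B = {} \<Longrightarrow> \<mu> (A \<union> B) = \<mu> A + \<mu> B"
  using charge by (simp add: charge_def additive_def)

lemma charge_split: "A \<in> F \<Longrightarrow> B \<in> F \<Longrightarrow> \<mu> A = \<mu> (A \<inter> B) + \<mu> (A - B)"
  using charge_disjoint_Un[of "A \<inter> B" "A - B"] by (simp add: Int_Diff_disjoint Int_Diff_Un Diff Int)

lemma charge_mono: "A \<in> F \<Longrightarrow> B \<in> F \<Longrightarrow> A \<subseteq> B \<Longrightarrow> \<mu> A \<le> \<mu> B"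
  using charge_split[of B A] charge_nonneg[of "B - A"] by (simp add: Int_absorb1 Diff)

lemma charge_Compl: "A \<in> F \<Longrightarrow> \<mu> (X - A) = \<mu> X - \<mu> A"
  using charge_split[of X A] sets_into_space by (simp add: Int_absorb1)

lemma charge_Un_le: "A \<in> F \<Longrightarrow> B \<in> F \<Longrightarrow> \<mu> (A \<union> B) \<le> \<mu> A + \<mu> B"
  using charge_disjoint_Un[of A "B - A"] charge_mono[of "B - A" B] by (simp add: Diff)

lemma charge_UN_le: "finite I \<Longrightarrow> A ` I \<subseteq> F \<Longrightarrow> \<mu> (\<Union>i\<in>I. A i) \<le> (\<Sum>i\<in>I. \<mu> (A i))"
proof (induction I rule: finite_induct)
  case empty
  then show ?case by (simp add: charge_empty)
next
  case (insert i I)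
  then have "(\<Union>i\<in>I. A i) \<in> F"
    by (intro finite_UN) auto
  then show ?case
    using insert charge_Un_le[of "A i" "\<Union>i\<in>I. A i"] by simp
qed

lemma charge_null_mono: "\<mu> B = 0 \<Longrightarrow> A \<in> F \<Longrightarrow> B \<in> F \<Longrightarrow> A \<subseteq> B \<Longrightarrow> \<mu> A = 0"
  using charge_mono[of A B] charge_nonneg[of A] by simp

lemma charge_null_Un: "\<mu> A = 0 \<Longrightarrow> \<mu> B = 0 \<Longrightarrow> A \<in> F \<Longrightarrow> B \<in> F \<Longrightarrow> \<mu> (A \<union> B) = 0"
  using charge_Un_le[of A B] charge_nonneg[of "A \<union> B"] by (simp add: Un)

lemma charge_null_UN:
  assumes "finite I" "A ` I \<subseteq> F" "\<And>i. i \<in> I \<Longrightarrow> \<mu> (A i) = 0"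
  shows "\<mu> (\<Union>i\<in>I. A i) = 0"
proof -
  have "(\<Union>i\<in>I. A i) \<in> F"
    using assms by (intro finite_UN) auto
  then show ?thesis
    using charge_UN_le[of I A] charge_nonneg[of "\<Union>i\<in>I. A i"] assms by simp
qed

lemma charge_concentrated:
  assumes "\<mu> (X - D) = 0" "A \<in> F" "D \<in> F"
  shows "\<mu> A = \<mu> (A \<inter> D)"
proof -
  have "A - D \<subseteq> X - D"
    using sets_into_space[OF \<open>A \<in> F\<close>] by blast
  then show ?thesis
    using charge_split[of A D] charge_null_mono[OF assms(1), of "A - D"] assms by (simp add: Diff)
qed

text \<open>\<open>lim\<close> is meaningful only for convergent sequences. Here convergence comes
  from monotonicity and the bound \<open>\<mu> X\<close>.\<close>

lemma charge_incseq_lim: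
  assumes "range A \<subseteq> F" "incseq A"
  shows "(\<lambda>i. \<mu> (A i)) \<longlonglongrightarrow> lim (\<lambda>i. \<mu> (A i))" "\<mu> (A i) \<le> lim (\<lambda>i. \<mu> (A i))"
proof -
  have inc: "incseq (\<lambda>i. \<mu> (A i))"
    using assms by (intro monoI charge_mono) (auto dest: monoD)
  have "\<mu> (A i) \<le> \<mu> X" for i
    using assms sets_into_space by (intro charge_mono) auto
  then have "convergent (\<lambda>i. \<mu> (A i))"
    using inc by (intro Bseq_mono_convergent) (auto intro!: BseqI'[of _ "\<mu> X"] dest: monoD
        simp: charge_nonneg image_subset_iff assms(1)[unfolded image_subset_iff])
  then show lim: "(\<lambda>i. \<mu> (A i)) \<longlonglongrightarrow> lim (\<lambda>i. \<mu> (A i))"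
    by (simp add: convergent_LIMSEQ_iff)
  show "\<mu> (A i) \<le> lim (\<lambda>i. \<mu> (A i))"
    using incseq_le[OF inc lim] .
qed

lemma charge_incseq_lim_le:
  assumes "range A \<subseteq> F" "incseq A" "\<And>i. \<mu> (A i) \<le> c"
  shows "lim (\<lambda>i. \<mu> (A i)) \<le> c"
  using charge_incseq_lim(1)[OF assms(1,2)] assms(3) by (intro LIMSEQ_le_const2) auto

text \<open>On a \<open>\<sigma>\<close>-algebra, the tolerance \<open>\<epsilon>\<close> in the additive property can be removed: sets \<open>B n\<close> that
  are good for \<open>\<epsilon> = 1 / (n + 1)\<close> are interpolated by \<open>\<Union>n. A n \<inter> B 0 \<inter> \<dots> \<inter> B n\<close>.\<close>

lemma additive_property_exact:
  assumes "sigma_algebra X F" and ap: "additive_property F \<mu>"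
    and A: "range A \<subseteq> F" "incseq A"
  obtains B where "B \<in> F" "\<mu> B \<le> lim (\<lambda>i. \<mu> (A i))" "\<And>i. \<mu> (A i - B) = 0"
proof -
  interpret sigma_algebra X F by fact
  let ?l = "lim (\<lambda>i. \<mu> (A i))"
  have AF: "A i \<in> F" for i
    using A by auto
  have "\<exists>B\<in>F. \<mu> B \<le> ?l + inverse (real (Suc n)) \<and> (\<forall>i. \<mu> (A i - B) = 0)" for n
    using ap A unfolding additive_property_def by simp
  then obtain B where B: "\<And>n. B n \<in> F" "\<And>n. \<mu> (B n) \<le> ?l + inverse (real (Suc n))"
    "\<And>n i. \<mu> (A i - B n) = 0"
    by metis
  define C where "C n = A n \<inter> (\<Inter>k\<le>n. B k)" for n
  have CF: "C n \<in> F" for n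
    using AF B by (auto simp: C_def)
  have UF: "(\<Union>n. C n) \<in> F"
    using CF by auto
  show ?thesis
  proof
    show "(\<Union>n. C n) \<in> F" by fact
    show "\<mu> (A i - (\<Union>n. C n)) = 0" for i
    proof (rule charge_null_mono)
      show "\<mu> (\<Union>k\<le>i. A i - B k) = 0"
        using AF B by (intro charge_null_UN) auto
      show "(\<Union>k\<le>i. A i - B k) \<in> F"
        using AF B by (intro finite_UN) auto
      show "A i - (\<Union>n. C n) \<in> F"
        using AF UF by auto
      show "A i - (\<Union>n. C n) \<subseteq> (\<Union>k\<le>i. A i - B k)"
        by (auto simp: C_def)
    qed
    have le: "\<mu> (\<Union>n. C n) \<le> ?l + inverse (real (Suc k))" for k
    proof -
      \<comment> \<open>A point of \<open>C n\<close> lies in \<open>B k\<close> if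
        \<open>n > k\<close>, and in \<open>A n\<close>, hence in \<open>A k\<close>, if
        \<open>n \<le> k\<close>. The part outside \<open>B k\<close> is therefore null.\<close>
      have "(\<Union>n. C n) \<subseteq> B k \<union> (A k - B k)"
      proof
        fix x assume "x \<in> (\<Union>n. C n)"
        then obtain n where "x \<in> C n" by blast
        moreover have "A n \<subseteq> A k" if "n \<le> k"
          using A(2) that by (rule monoD)
        ultimately show "x \<in> B k \<union> (A k - B k)"
          by (cases "n \<le> k") (auto simp: C_def)
      qed
      then have "\<mu> (\<Union>n. C n) \<le> \<mu> (B k \<union> (A k - B k))"
        using AF B UF by (intro charge_mono) auto
      also have "\<dots> \<le> \<mu> (B k) + \<mu> (A k - B k)"
        using AF B by (intro charge_Un_le) auto
      also have "\<dots> \<le> ?l + inverse (real (Suc k))"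
        using B by simp
      finally show ?thesis .
    qed
    have "(\<lambda>k. ?l + inverse (real (Suc k))) \<longlonglongrightarrow> ?l + 0"
      by (intro tendsto_add tendsto_const LIMSEQ_inverse_real_of_nat)
    then show "\<mu> (\<Union>n. C n) \<le> ?l"
      using le by (intro LIMSEQ_le_const[where X = "\<lambda>k. ?l + inverse (real (Suc k))"]) auto
  qed
qed

end

section \<open>Singular summands of a charge with the additive property\<close>

lemma charge_algebra: "charge X F \<mu> \<Longrightarrow> algebra X F"
  by (simp add: charge_def)

text \<open>A set \<open>B\<close> that is good for the partial unions \<open>A n\<close> of
  separating sets \<open>D n\<close> contains each \<open>D n\<close> up to a null set. So
  \<open>\<nu>\<^sub>2\<close> off \<open>B\<close> is at most its value off \<open>D n\<close>,
  which tends to 0.\<close>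

lemma additive_property_singular_imp_approx:
  assumes "sigma_algebra X F" "charge X F \<mu>" "charge X F \<nu>\<^sub>1" "charge X F \<nu>\<^sub>2"
    and sum: "\<And>A. A \<in> F \<Longrightarrow> \<mu> A = \<nu>\<^sub>1 A + \<nu>\<^sub>2 A"
    and ap: "additive_property F \<mu>" and sing: "singular_charges X F \<nu>\<^sub>1 \<nu>\<^sub>2"
    and "\<epsilon> > 0"
  obtains B where "B \<in> F" "\<nu>\<^sub>1 B \<le> \<epsilon>" "\<nu>\<^sub>2 (X - B) = 0"
proof -
  interpret sigma_algebra X F by fact
  \<comment> \<open>The tolerances sum to \<epsilon>, which bounds \<open>\<nu>\<^sub>1\<close> on
    all the partial unions at once.\<close>
  have "\<exists>D\<in>F. \<nu>\<^sub>1 D < \<epsilon> * (1/2)^Suc n \<and> \<nu>\<^sub>2 (X - D) < \<epsilon> * (1/2)^Suc n" for n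
    using sing[unfolded singular_charges_def, rule_format, of "\<epsilon> * (1/2)^Suc n"] \<open>\<epsilon> > 0\<close> by simp
  then obtain D where D: "\<And>n. D n \<in> F" "\<And>n. \<nu>\<^sub>1 (D n) < \<epsilon> * (1/2)^Suc n"
    "\<And>n. \<nu>\<^sub>2 (X - D n) < \<epsilon> * (1/2)^Suc n"
    by metis
  define A where "A n = (\<Union>k\<le>n. D k)" for n
  have AF: "A n \<in> F" for n
    unfolding A_def using D by (intro finite_UN) auto
  have inc: "incseq A"
    unfolding A_def by (rule monoI, rule UN_mono) auto
  have \<nu>\<^sub>1A: "\<nu>\<^sub>1 (A n) \<le> \<epsilon>" for n
  proof -
    have "\<nu>\<^sub>1 (A n) \<le> (\<Sum>k\<le>n. \<nu>\<^sub>1 (D k))"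
      unfolding A_def using D by (intro charge_UN_le[OF assms(3)]) auto
    also have "\<dots> \<le> (\<Sum>k\<le>n. \<epsilon> * (1/2)^Suc k)"
      using D(2) by (intro sum_mono less_imp_le)
    also have "\<dots> = \<epsilon> * (\<Sum>k\<le>n. (1/2)^Suc k)"
      by (simp add: sum_distrib_left)
    also have "\<dots> \<le> \<epsilon> * 1"
    proof (rule mult_left_mono)
      have "(\<lambda>k. (1/2::real)^Suc k) sums 1"
        by (rule power_half_series)
      then show "(\<Sum>k\<le>n. (1/2::real)^Suc k) \<le> 1"
        using sum_le_suminf[of "\<lambda>k. (1/2::real)^Suc k" "{..n}"] by (simp add: sums_iff)
    qed (use \<open>\<epsilon> > 0\<close> in simp)
    finally show ?thesis by simp
  qed
  obtain B where B: "B \<in> F" "\<mu> B \<le> lim (\<lambda>i. \<mu> (A i))" "\<And>i. \<mu> (A i - B) = 0"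
    using additive_property_exact[OF assms(2,1) ap, of A] AF inc by blast
  have \<nu>\<^sub>2B: "\<nu>\<^sub>2 (X - B) = 0"
  proof -
    have "\<nu>\<^sub>2 (X - B) \<le> \<epsilon> * (1/2)^Suc n" for n
    proof -
      have 0: "\<nu>\<^sub>2 (A n - B) = 0"
        using B(3)[of n] sum[of "A n - B"] AF[of n] B(1)
          charge_nonneg[OF assms(3), of "A n - B"] charge_nonneg[OF assms(4), of "A n - B"]
        by (simp add: Diff)
      have "\<nu>\<^sub>2 (X - B) \<le> \<nu>\<^sub>2 ((X - D n) \<union> (A n - B))"
        by (intro charge_mono[OF assms(4)] Un Diff top AF B(1) D(1)) (auto simp: A_def)
      also have "\<dots> \<le> \<nu>\<^sub>2 (X - D n) + \<nu>\<^sub>2 (A n - B)"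
        using AF B D by (intro charge_Un_le[OF assms(4)]) auto
      finally show ?thesis
        using D(3)[of n] 0 by simp
    qed
    moreover have "(\<lambda>n. \<epsilon> * (1/2)^Suc n) \<longlonglongrightarrow> \<epsilon> * 0"
      by (intro tendsto_mult_left LIMSEQ_Suc LIMSEQ_realpow_zero) auto
    ultimately have "\<nu>\<^sub>2 (X - B) \<le> \<epsilon> * 0"
      by (intro LIMSEQ_le_const[where X = "\<lambda>n. \<epsilon> * (1/2)^Suc n"]) auto
    then show ?thesis
      using charge_nonneg[OF assms(4), of "X - B"] B(1) by auto
  qed
  \<comment> \<open>Since \<open>\<nu>\<^sub>2 B = \<nu>\<^sub>2 X\<close>, the resulting bound on
    \<open>\<mu> B\<close> leaves at most \<epsilon> for \<open>\<nu>\<^sub>1 B\<close>.\<close>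
  have "\<mu> (A n) \<le> \<epsilon> + \<nu>\<^sub>2 X" for n
    using sum[OF AF[of n]] \<nu>\<^sub>1A[of n] charge_mono[OF assms(4) AF[of n] top sets_into_space[OF AF[of n]]]
    by simp
  then have "\<mu> B \<le> \<epsilon> + \<nu>\<^sub>2 X"
    using B(2) charge_incseq_lim_le[OF assms(2), of A] AF inc by (meson image_subsetI order_trans)
  then have "\<nu>\<^sub>1 B \<le> \<epsilon>"
    using sum[OF B(1)] charge_Compl[OF assms(4) B(1)] \<nu>\<^sub>2B by simp
  then show ?thesis
    using that B(1) \<nu>\<^sub>2B by blast
qed

text \<open>The complements of the approximate separators are null for \<open>\<nu>\<^sub>2\<close>
  and exhaust \<open>\<nu>\<^sub>1\<close>. A second use of the additive property, on their partial
  unions, replaces the exhaustion by a single set.\<close>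

lemma additive_property_singular_imp_strongly_singular:
  assumes "sigma_algebra X F" "charge X F \<mu>" "charge X F \<nu>\<^sub>1" "charge X F \<nu>\<^sub>2"
    and sum: "\<And>A. A \<in> F \<Longrightarrow> \<mu> A = \<nu>\<^sub>1 A + \<nu>\<^sub>2 A"
    and ap: "additive_property F \<mu>" and sing: "singular_charges X F \<nu>\<^sub>1 \<nu>\<^sub>2"
  shows "strongly_singular_charges X F \<nu>\<^sub>1 \<nu>\<^sub>2"
proof -
  interpret sigma_algebra X F by fact
  have "\<exists>B\<in>F. \<nu>\<^sub>1 B \<le> inverse (real (Suc n)) \<and> \<nu>\<^sub>2 (X - B) = 0" for n
    using additive_property_singular_imp_approx[OF assms, of "inverse (real (Suc n))"] by auto
  then obtain B where B: "\<And>n. B n \<in> F" "\<And>n. \<nu>\<^sub>1 (B n) \<le> inverse (real (Suc n))"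
    "\<And>n. \<nu>\<^sub>2 (X - B n) = 0"
    by metis
  define C where "C n = (\<Union>k\<le>n. X - B k)" for n
  have CF: "C n \<in> F" for n
    unfolding C_def using B by (intro finite_UN) auto
  have inc: "incseq C"
    unfolding C_def by (rule monoI, rule UN_mono) auto
  have \<nu>\<^sub>2C: "\<nu>\<^sub>2 (C n) = 0" for n
    unfolding C_def using B by (intro charge_null_UN[OF assms(4)]) auto
  obtain D where D: "D \<in> F" "\<mu> D \<le> lim (\<lambda>i. \<mu> (C i))" "\<And>i. \<mu> (C i - D) = 0"
    using additive_property_exact[OF assms(2,1) ap, of C] CF inc by blast
  have \<nu>\<^sub>1D: "\<nu>\<^sub>1 (X - D) = 0"
  proof -
    have "\<nu>\<^sub>1 (X - D) \<le> inverse (real (Suc n))" for n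
    proof -
      have 0: "\<nu>\<^sub>1 (C n - D) = 0"
        using D(3)[of n] sum[of "C n - D"] CF[of n] D(1)
          charge_nonneg[OF assms(3), of "C n - D"] charge_nonneg[OF assms(4), of "C n - D"]
        by (simp add: Diff)
      have "\<nu>\<^sub>1 (X - D) \<le> \<nu>\<^sub>1 (B n \<union> (C n - D))"
        by (intro charge_mono[OF assms(3)] Un Diff top B(1) CF D(1)) (auto simp: C_def)
      also have "\<dots> \<le> \<nu>\<^sub>1 (B n) + \<nu>\<^sub>1 (C n - D)"
        using B CF D by (intro charge_Un_le[OF assms(3)]) auto
      finally show ?thesis
        using B(2)[of n] 0 by simp
    qed
    then have "\<nu>\<^sub>1 (X - D) \<le> 0"
      using LIMSEQ_inverse_real_of_nat
      by (intro LIMSEQ_le_const[where X = "\<lambda>n. inverse (real (Suc n))"]) auto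
    then show ?thesis
      using charge_nonneg[OF assms(3), of "X - D"] D(1) by auto
  qed
  \<comment> \<open>As \<open>D\<close> already carries all of \<open>\<nu>\<^sub>1\<close>,
    bounding \<open>\<mu> D\<close> by \<open>\<nu>\<^sub>1 X\<close> forces
    \<open>\<nu>\<^sub>2 D = 0\<close>.\<close>
  have "\<mu> (C n) \<le> \<nu>\<^sub>1 X" for n
    using sum[OF CF[of n]] \<nu>\<^sub>2C[of n] charge_mono[OF assms(3) CF[of n] top sets_into_space[OF CF[of n]]]
    by simp
  then have "\<mu> D \<le> \<nu>\<^sub>1 X"
    using D(2) charge_incseq_lim_le[OF assms(2), of C] CF inc by (meson image_subsetI order_trans)
  then have "\<nu>\<^sub>2 D = 0"
    using sum[OF D(1)] charge_Compl[OF assms(3) D(1)] \<nu>\<^sub>1D charge_nonneg[OF assms(4) D(1)] by simp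
  moreover have "X - (X - D) = D"
    using sets_into_space[OF D(1)] by blast
  ultimately show ?thesis
    unfolding strongly_singular_charges_def using \<nu>\<^sub>1D D(1) by (intro bexI[of _ "X - D"]) auto
qed

section \<open>Series of charges\<close>

locale charge_series = sigma_algebra X F
  for X :: "'a set" and F :: "'a set set" +
  fixes \<mu>s :: "nat \<Rightarrow> 'a set \<Rightarrow> real" and \<mu> :: "'a set \<Rightarrow> real"
  assumes charges: "\<And>i. charge X F (\<mu>s i)"
    and charge_total: "charge X F \<mu>"
    and sums_total: "\<And>A. A \<in> F \<Longrightarrow> (\<lambda>i. \<mu>s i A) sums \<mu> A"
begin

lemma sum_le_total: "finite J \<Longrightarrow> A \<in> F \<Longrightarrow> (\<Sum>j\<in>J. \<mu>s j A) \<le> \<mu> A"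
  using sum_le_suminf[of "\<lambda>j. \<mu>s j A" J] sums_total[of A] charge_nonneg[OF charges]
  by (simp add: sums_iff)

text \<open>Used with \<open>J = {i}\<close> for the sum of the other charges and with
  \<open>J = {..<N}\<close> for a tail of the series.\<close>

lemma charge_remainder: "finite J \<Longrightarrow> charge X F (\<lambda>A. \<mu> A - (\<Sum>j\<in>J. \<mu>s j A))"
  unfolding charge_def additive_def
  using sum_le_total algebra_axioms
  by (auto simp: charge_empty[OF charges] charge_empty[OF charge_total] sum.distrib
      charge_disjoint_Un[OF charges] charge_disjoint_Un[OF charge_total])

lemma member_le_total: "A \<in> F \<Longrightarrow> \<mu>s i A \<le> \<mu> A"
  using sum_le_total[of "{i}" A] by simp

lemma null_member: "\<mu> A = 0 \<Longrightarrow> A \<in> F \<Longrightarrow> \<mu>s i A = 0"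
  using member_le_total[of A i] charge_nonneg[OF charges, of A i] by simp

lemma total_eq_member:
  assumes "A \<in> F" "\<And>j. j \<noteq> i \<Longrightarrow> \<mu>s j A = 0"
  shows "\<mu> A = \<mu>s i A"
proof -
  have "(\<lambda>j. \<mu>s j A) sums (\<Sum>j\<in>{i}. \<mu>s j A)"
    using assms(2) by (intro sums_finite) auto
  then show ?thesis
    using sums_unique2[OF sums_total[OF assms(1)]] by simp
qed

text \<open>Only finitely many charges have to be separated from \<open>\<mu>s i\<close>, because
  the others form a tail of total mass below \<epsilon>/2.\<close>

lemma singular_remainder:
  assumes sing: "\<And>j. j \<noteq> i \<Longrightarrow> singular_charges X F (\<mu>s i) (\<mu>s j)"
  shows "singular_charges X F (\<mu>s i) (\<lambda>A. \<mu> A - \<mu>s i A)"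
  unfolding singular_charges_def
proof (intro allI impI)
  fix \<epsilon> :: real assume "\<epsilon> > 0"
  have "(\<lambda>N. \<Sum>j<N. \<mu>s j X) \<longlonglongrightarrow> \<mu> X"
    using sums_total[OF top] by (simp add: sums_def)
  then have "\<forall>\<^sub>F N in sequentially. \<mu> X - \<epsilon>/2 < (\<Sum>j<N. \<mu>s j X)"
    using \<open>\<epsilon> > 0\<close> by (intro order_tendstoD) auto
  \<comment> \<open>\<open>i < N\<close> makes \<open>\<mu>s i\<close> one of the first
    \<open>N\<close> charges, so the remainder splits into the charges in \<open>J\<close> and the
    tail.\<close>
  then have "\<forall>\<^sub>F N in sequentially. \<mu> X - \<epsilon>/2 < (\<Sum>j<N. \<mu>s j X) \<and> i < N"
    using eventually_gt_at_top[of i] by eventually_elim auto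
  then obtain N where N: "\<mu> X - \<epsilon>/2 < (\<Sum>j<N. \<mu>s j X)" "i < N"
    by (auto simp: eventually_sequentially)
  define J where "J = {..<N} - {i}"
  \<comment> \<open>\<open>J\<close> has at most \<open>N\<close> elements, so the separations
    together cost at most \<epsilon>/2.\<close>
  define \<delta> where "\<delta> = \<epsilon> / (2 * real N)"
  have "\<delta> > 0"
    using \<open>\<epsilon> > 0\<close> N(2) by (simp add: \<delta>_def)
  have J\<delta>: "real (card J) * \<delta> \<le> \<epsilon> / 2"
  proof -
    have "real (card J) * \<delta> \<le> real N * \<delta>"
      using \<open>\<delta> > 0\<close> card_mono[of "{..<N}" J] by (intro mult_right_mono) (auto simp: J_def)
    also have "\<dots> = \<epsilon> / 2"
      using N(2) by (simp add: \<delta>_def)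
    finally show ?thesis .
  qed
  have "\<forall>j\<in>J. \<exists>D\<in>F. \<mu>s i D < \<delta> \<and> \<mu>s j (X - D) < \<delta>"
    using sing \<open>\<delta> > 0\<close> by (auto simp: singular_charges_def J_def)
  then obtain D where D: "\<And>j. j \<in> J \<Longrightarrow> D j \<in> F" "\<And>j. j \<in> J \<Longrightarrow> \<mu>s i (D j) < \<delta>"
    "\<And>j. j \<in> J \<Longrightarrow> \<mu>s j (X - D j) < \<delta>"
    by metis
  let ?D = "\<Union>j\<in>J. D j"
  have "finite J"
    by (simp add: J_def)
  have DF: "?D \<in> F" "X - ?D \<in> F"
    using D \<open>finite J\<close> by (auto intro!: finite_UN)
  have "\<mu>s i ?D \<le> (\<Sum>j\<in>J. \<mu>s i (D j))"
    using D \<open>finite J\<close> by (intro charge_UN_le[OF charges]) auto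
  also have "\<dots> \<le> (\<Sum>j\<in>J. \<delta>)"
    using D by (intro sum_mono less_imp_le)
  also have "\<dots> < \<epsilon>"
    using J\<delta> \<open>\<epsilon> > 0\<close> by simp
  finally have 1: "\<mu>s i ?D < \<epsilon>" .
  have eq: "(\<Sum>j<N. \<mu>s j A) = \<mu>s i A + (\<Sum>j\<in>J. \<mu>s j A)" for A
    using N(2) by (simp add: J_def sum.remove)
  \<comment> \<open>The tail is itself a charge, hence no larger on \<open>X - ?D\<close> than on
    \<open>X\<close>.\<close>
  have "\<mu> (X - ?D) - (\<Sum>j<N. \<mu>s j (X - ?D)) \<le> \<mu> X - (\<Sum>j<N. \<mu>s j X)"
    using DF by (intro charge_mono[OF charge_remainder]) auto
  moreover have "(\<Sum>j\<in>J. \<mu>s j (X - ?D)) \<le> (\<Sum>j\<in>J. \<delta>)"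
  proof (rule sum_mono)
    fix j assume j: "j \<in> J"
    have "\<mu>s j (X - ?D) \<le> \<mu>s j (X - D j)"
      using DF(2) j D(1)[OF j] by (intro charge_mono[OF charges]) auto
    then show "\<mu>s j (X - ?D) \<le> \<delta>"
      using D(3)[OF j] by simp
  qed
  ultimately have "\<mu> (X - ?D) - \<mu>s i (X - ?D) < \<epsilon>"
    using eq[of "X - ?D"] J\<delta> N(1) by simp
  then show "\<exists>D\<in>F. \<mu>s i D < \<epsilon> \<and> \<mu> (X - D) - \<mu>s i (X - D) < \<epsilon>"
    using 1 DF by blast
qed

text \<open>Separating \<open>\<mu>s i\<close> from the sum of all the others at once avoids
  combining infinitely many separating sets, on whose countable unions finite additivity gives no
  control.\<close>

lemma additive_property_imp_carrier:
  assumes sing: "\<And>j. j \<noteq> i \<Longrightarrow> singular_charges X F (\<mu>s i) (\<mu>s j)"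
    and ap: "additive_property F \<mu>"
  obtains D where "D \<in> F" "\<mu>s i (X - D) = 0" "\<And>j. j \<noteq> i \<Longrightarrow> \<mu>s j D = 0"
proof -
  have "charge X F (\<lambda>A. \<mu> A - \<mu>s i A)"
    using charge_remainder[of "{i}"] by simp
  then have "strongly_singular_charges X F (\<mu>s i) (\<lambda>A. \<mu> A - \<mu>s i A)"
    using ap singular_remainder[OF sing] sigma_algebra_axioms charge_total charges
    by (intro additive_property_singular_imp_strongly_singular[of X F \<mu>]) auto
  then obtain E where E: "E \<in> F" "\<mu>s i E = 0" "\<mu> (X - E) - \<mu>s i (X - E) = 0"
    by (auto simp: strongly_singular_charges_def)
  show ?thesis
  proof
    show "X - E \<in> F"
      using E by auto
    show "\<mu>s i (X - (X - E)) = 0"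
      using E sets_into_space[OF E(1)] by (simp add: double_diff)
    fix j assume "j \<noteq> i"
    then have "\<mu>s i (X - E) + \<mu>s j (X - E) \<le> \<mu> (X - E)"
      using sum_le_total[of "{i, j}" "X - E"] E(1) by auto
    then show "\<mu>s j (X - E) = 0"
      using E charge_nonneg[OF charges, of "X - E" j] by (simp add: Diff)
  qed
qed

text \<open>On subsets of \<open>D\<close> the total coincides with \<open>\<mu>s i\<close>, so the
  property of the total is applied to the traces \<open>A n \<inter> D\<close>.\<close>

lemma additive_property_member:
  assumes ap: "additive_property F \<mu>"
    and D: "D \<in> F" "\<mu>s i (X - D) = 0" "\<And>j. j \<noteq> i \<Longrightarrow> \<mu>s j D = 0"
  shows "additive_property F (\<mu>s i)"
  unfolding additive_property_def
proof (intro allI impI)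
  fix \<epsilon> :: real and A :: "nat \<Rightarrow> 'a set"
  assume "\<epsilon> > 0" and A: "range A \<subseteq> F \<and> incseq A"
  then have AF: "A n \<in> F" for n by auto
  have "range (\<lambda>n. A n \<inter> D) \<subseteq> F \<and> incseq (\<lambda>n. A n \<inter> D)"
    using A D(1) by (auto simp: incseq_def subset_iff image_subset_iff)
  then obtain B where B: "B \<in> F" "\<mu> B \<le> lim (\<lambda>n. \<mu> (A n \<inter> D)) + \<epsilon>" "\<And>n. \<mu> (A n \<inter> D - B) = 0"
    using ap \<open>\<epsilon> > 0\<close> unfolding additive_property_def by meson
  have "\<mu> (A n \<inter> D) = \<mu>s i (A n)" for n
  proof -
    have "\<mu> (A n \<inter> D) = \<mu>s i (A n \<inter> D)"
      using D AF by (intro total_eq_member charge_null_mono[OF charges D(3)]) auto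
    then show ?thesis
      using charge_concentrated[OF charges D(2) AF D(1), of n] by simp
  qed
  then have "\<mu>s i B \<le> lim (\<lambda>n. \<mu>s i (A n)) + \<epsilon>"
    using B(2) member_le_total[OF B(1), of i] by simp
  moreover have "\<mu>s i (A n - B) = 0" for n
  proof -
    have "(A n - B) \<inter> D = A n \<inter> D - B"
      by blast
    then show ?thesis
      using charge_concentrated[OF charges D(2) Diff[OF AF B(1)] D(1), of n]
        null_member[OF B(3)[of n], of i] AF B(1) D(1) by (simp add: Diff Int)
  qed
  ultimately show "\<exists>B\<in>F. \<mu>s i B \<le> lim (\<lambda>n. \<mu>s i (A n)) + \<epsilon> \<and> (\<forall>n. \<mu>s i (A n - B) = 0)"
    using B(1) by blast
qed

lemma additive_property_total:
  assumes ap: "\<And>i. additive_property F (\<mu>s i)"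
    and D: "\<And>i. D i \<in> F" "\<And>i. \<mu>s i (X - D i) = 0" "\<And>i j. j \<noteq> i \<Longrightarrow> \<mu>s j (D i) = 0"
  shows "additive_property F \<mu>"
  unfolding additive_property_def
proof (intro allI impI)
  fix \<epsilon> :: real and A :: "nat \<Rightarrow> 'a set"
  assume "\<epsilon> > 0" and A: "range A \<subseteq> F \<and> incseq A"
  then have AF: "A n \<in> F" for n by auto
  \<comment> \<open>The finitely many removed sets \<open>D j\<close> are null for
    \<open>\<mu>s i\<close>, so the pairwise disjoint \<open>E i\<close> remain carriers.\<close>
  define E where "E i = D i - (\<Union>j<i. D j)" for i
  have EF: "E i \<in> F" for i
    using D(1) by (auto simp: E_def intro!: finite_UN)
  have E_compl: "\<mu>s i (X - E i) = 0" for i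
  proof -
    have "\<mu>s i (\<Union>j<i. D j) = 0"
      using D by (intro charge_null_UN[OF charges]) auto
    then have "\<mu>s i ((X - D i) \<union> (\<Union>j<i. D j)) = 0"
      using D by (intro charge_null_Un[OF charges]) (auto intro!: finite_UN)
    then show ?thesis
      by (rule charge_null_mono[OF charges]) (use EF D(1) in \<open>auto simp: E_def intro!: finite_UN\<close>)
  qed
  have E_disj: "E i \<inter> E j = {}" if "i \<noteq> j" for i j
    using that by (cases i j rule: linorder_cases) (auto simp: E_def)
  have "\<exists>B\<in>F. \<mu>s i B \<le> lim (\<lambda>n. \<mu>s i (A n)) + \<epsilon> * (1/2)^Suc i \<and> (\<forall>n. \<mu>s i (A n - B) = 0)" for i
    using ap[of i, unfolded additive_property_def, rule_format, of "\<epsilon> * (1/2)^Suc i" A] A \<open>\<epsilon> > 0\<close>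
    by simp
  then obtain B where B: "\<And>i. B i \<in> F"
    "\<And>i. \<mu>s i (B i) \<le> lim (\<lambda>n. \<mu>s i (A n)) + \<epsilon> * (1/2)^Suc i" "\<And>i n. \<mu>s i (A n - B i) = 0"
    by metis
  \<comment> \<open>By disjointness \<open>C\<close> meets \<open>E i\<close> only inside
    \<open>B i\<close>, so \<open>\<mu>s i\<close>, which is carried by \<open>E i\<close>, cannot
    tell \<open>C\<close> from a part of \<open>B i\<close>.\<close>
  define C where "C = (\<Union>i. B i \<inter> E i)"
  have CF: "C \<in> F"
    using B(1) EF by (auto simp: C_def)
  have C_Int: "C \<inter> E i = B i \<inter> E i" for i
  proof
    show "C \<inter> E i \<subseteq> B i \<inter> E i"
    proof
      fix x assume "x \<in> C \<inter> E i"
      then obtain j where "x \<in> B j" "x \<in> E j" "x \<in> E i"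
        by (auto simp: C_def)
      moreover from this have "j = i"
        using E_disj[of j i] by blast
      ultimately show "x \<in> B i \<inter> E i" by simp
    qed
  qed (auto simp: C_def)
  have \<mu>sC: "\<mu>s i C \<le> lim (\<lambda>n. \<mu>s i (A n)) + \<epsilon> * (1/2)^Suc i" for i
  proof -
    have "\<mu>s i C = \<mu>s i (B i \<inter> E i)"
      using charge_concentrated[OF charges E_compl CF EF] C_Int by simp
    also have "\<dots> \<le> \<mu>s i (B i)"
      using B(1) EF by (intro charge_mono[OF charges]) auto
    finally show ?thesis
      using B(2)[of i] by simp
  qed
  note lims = charge_incseq_lim[OF charges conjunct1[OF A] conjunct2[OF A]]
  \<comment> \<open>This avoids exchanging the limit with the infinite sum: finite partial sums stay
    below \<open>\<mu> (A n)\<close> for each \<open>n\<close>, and \<open>N\<close> tends to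
    infinity only at the end.\<close>
  have "(\<Sum>i<N. lim (\<lambda>n. \<mu>s i (A n))) \<le> lim (\<lambda>n. \<mu> (A n))" for N
  proof (rule LIMSEQ_le)
    show "(\<lambda>n. \<Sum>i<N. \<mu>s i (A n)) \<longlonglongrightarrow> (\<Sum>i<N. lim (\<lambda>n. \<mu>s i (A n)))"
      by (intro tendsto_sum lims)
    show "(\<lambda>n. \<mu> (A n)) \<longlonglongrightarrow> lim (\<lambda>n. \<mu> (A n))"
      using A by (intro charge_incseq_lim(1)[OF charge_total]) auto
    show "\<exists>n0. \<forall>n\<ge>n0. (\<Sum>i<N. \<mu>s i (A n)) \<le> \<mu> (A n)"
      using AF by (intro exI allI impI sum_le_total) auto
  qed
  moreover have "(\<Sum>i<N. \<epsilon> * (1/2)^Suc i) \<le> \<epsilon>" for N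
  proof -
    have "(\<Sum>i<N. (1/2::real)^Suc i) \<le> 1"
      using sum_le_suminf[of "\<lambda>k. (1/2::real)^Suc k" "{..<N}"] power_half_series
      by (simp add: sums_iff)
    then have "\<epsilon> * (\<Sum>i<N. (1/2)^Suc i) \<le> \<epsilon> * 1"
      using \<open>\<epsilon> > 0\<close> by (intro mult_left_mono) auto
    then show ?thesis
      by (simp only: sum_distrib_left mult_1_right)
  qed
  moreover have "(\<Sum>i<N. \<mu>s i C) \<le> (\<Sum>i<N. lim (\<lambda>n. \<mu>s i (A n)) + \<epsilon> * (1/2)^Suc i)" for N
    by (intro sum_mono \<mu>sC)
  ultimately have "(\<Sum>i<N. \<mu>s i C) \<le> lim (\<lambda>n. \<mu> (A n)) + \<epsilon>" for N
    unfolding sum.distrib by (smt (verit))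
  moreover have "(\<lambda>N. \<Sum>i<N. \<mu>s i C) \<longlonglongrightarrow> \<mu> C"
    using sums_total[OF CF] by (simp add: sums_def)
  ultimately have "\<mu> C \<le> lim (\<lambda>n. \<mu> (A n)) + \<epsilon>"
    by (intro LIMSEQ_le_const2) auto
  moreover have "\<mu> (A n - C) = 0" for n
  proof -
    have "\<mu>s i (A n - C) = 0" for i
    proof -
      have "(A n - C) \<inter> E i = (A n - B i) \<inter> E i"
        using C_Int[of i] by blast
      then have "\<mu>s i (A n - C) = \<mu>s i (A n - B i)"
        using charge_concentrated[OF charges E_compl _ EF] AF B(1) CF by (simp add: Diff)
      then show ?thesis
        using B(3) by simp
    qed
    then show ?thesis
      using sums_total[OF Diff[OF AF CF], of n] by (simp add: sums_iff)
  qed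
  ultimately show "\<exists>B\<in>F. \<mu> B \<le> lim (\<lambda>n. \<mu> (A n)) + \<epsilon> \<and> (\<forall>n. \<mu> (A n - B) = 0)"
    using CF by blast
qed

end

text \<open>From left to right, the sets that strong singularity provides for the finitely many
  other charges not vanishing on \<open>E\<close> are cut away from \<open>E\<close>. Finiteness
  keeps their union null for \<open>\<mu>s i\<close>.\<close>

lemma strongly_singular_locally_finite_iff_carrier:
  fixes \<mu>s :: "nat \<Rightarrow> 'a set \<Rightarrow> real"
  assumes charges: "\<And>i. charge X F (\<mu>s i)"
  shows "(\<forall>i j. i \<noteq> j \<longrightarrow> strongly_singular_charges X F (\<mu>s i) (\<mu>s j)) \<and>
      (\<forall>i. \<exists>E\<in>F. \<mu>s i (X - E) = 0 \<and> finite {j. \<mu>s j E \<noteq> 0}) \<longleftrightarrow>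
    (\<forall>i. \<exists>D\<in>F. \<mu>s i (X - D) = 0 \<and> (\<forall>j. j \<noteq> i \<longrightarrow> \<mu>s j D = 0))" (is "?L \<longleftrightarrow> ?R")
proof
  interpret algebra X F
    using charge_algebra[OF charges] .
  show ?R if L: ?L
  proof
    fix i
    obtain E where E: "E \<in> F" "\<mu>s i (X - E) = 0" "finite {j. \<mu>s j E \<noteq> 0}"
      using conjunct2[OF L, rule_format, of i] by blast
    define J where "J = {j. \<mu>s j E \<noteq> 0} - {i}"
    have "finite J"
      using E by (simp add: J_def)
    have "\<forall>j\<in>J. \<exists>G\<in>F. \<mu>s i G = 0 \<and> \<mu>s j (X - G) = 0"
    proof
      fix j assume "j \<in> J"
      then have "strongly_singular_charges X F (\<mu>s i) (\<mu>s j)"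
        using conjunct1[OF L] by (simp add: J_def)
      then show "\<exists>G\<in>F. \<mu>s i G = 0 \<and> \<mu>s j (X - G) = 0"
        by (simp add: strongly_singular_charges_def)
    qed
    then obtain G where G: "\<And>j. j \<in> J \<Longrightarrow> G j \<in> F" "\<And>j. j \<in> J \<Longrightarrow> \<mu>s i (G j) = 0"
      "\<And>j. j \<in> J \<Longrightarrow> \<mu>s j (X - G j) = 0"
      by metis
    let ?G = "\<Union>j\<in>J. G j"
    have GF: "?G \<in> F"
      using G \<open>finite J\<close> by (intro finite_UN) auto
    show "\<exists>D\<in>F. \<mu>s i (X - D) = 0 \<and> (\<forall>j. j \<noteq> i \<longrightarrow> \<mu>s j D = 0)"
    proof (intro bexI[of _ "E - ?G"] conjI allI impI)
      show EGF: "E - ?G \<in> F"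
        using E GF by blast
      have "\<mu>s i ?G = 0"
        using G \<open>finite J\<close> by (intro charge_null_UN[OF charges]) auto
      then have "\<mu>s i ((X - E) \<union> ?G) = 0"
        using E GF by (intro charge_null_Un[OF charges]) auto
      then show "\<mu>s i (X - (E - ?G)) = 0"
        by (rule charge_null_mono[OF charges]) (use E GF EGF in auto)
      fix j assume "j \<noteq> i"
      show "\<mu>s j (E - ?G) = 0"
      proof (cases "j \<in> J")
        case True
        show ?thesis
          using sets_into_space[OF E(1)] True EGF G(1)[OF True]
          by (intro charge_null_mono[OF charges G(3)[OF True]]) auto
      next
        case False
        then have "\<mu>s j E = 0"
          using \<open>j \<noteq> i\<close> by (simp add: J_def)
        then show ?thesis
          by (rule charge_null_mono[OF charges]) (use E EGF in auto)
      qed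
    qed
  qed
  show ?L if R: ?R
  proof (intro conjI allI impI)
    fix i j :: nat assume "i \<noteq> j"
    then obtain D where D: "D \<in> F" "\<mu>s i (X - D) = 0" "\<mu>s j D = 0"
      using R[rule_format, of i] by auto
    then show "strongly_singular_charges X F (\<mu>s i) (\<mu>s j)"
      unfolding strongly_singular_charges_def
      using sets_into_space[OF D(1)] by (intro bexI[of _ "X - D"]) (auto simp: double_diff)
  next
    fix i
    obtain D where D: "D \<in> F" "\<mu>s i (X - D) = 0" "\<And>j. j \<noteq> i \<Longrightarrow> \<mu>s j D = 0"
      using R[rule_format, of i] by auto
    then have "{j. \<mu>s j D \<noteq> 0} \<subseteq> {i}"
      by blast
    then show "\<exists>E\<in>F. \<mu>s i (X - E) = 0 \<and> finite {j. \<mu>s j E \<noteq> 0}"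
      using D by (meson finite.emptyI finite.insertI finite_subset)
  qed
qed

section \<open>Ultrafilters and the Stone space\<close>

text \<open>Ideals rather than filters, because the later constructions start from collections of
  small sets. Properness is demanded separately, as \<open>X \<notin> I\<close>.\<close>

definition set_ideal :: "'a set set \<Rightarrow> 'a set set \<Rightarrow> bool" where
  "set_ideal F I \<longleftrightarrow> I \<subseteq> F \<and> {} \<in> I \<and> (\<forall>A\<in>I. \<forall>B\<in>I. A \<union> B \<in> I) \<and>
     (\<forall>A\<in>I. \<forall>B\<in>F. B \<subseteq> A \<longrightarrow> B \<in> I)"

lemma set_idealD:
  assumes "set_ideal F I"
  shows "A \<in> I \<Longrightarrow> A \<in> F" "{} \<in> I" "A \<in> I \<Longrightarrow> B \<in> I \<Longrightarrow> A \<union> B \<in> I"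
    "A \<in> I \<Longrightarrow> B \<in> F \<Longrightarrow> B \<subseteq> A \<Longrightarrow> B \<in> I"
  using assms unfolding set_ideal_def by (metis subsetD)+

lemma set_ideal_Union_chain:
  assumes "C \<noteq> {}" "subset.chain {I. set_ideal F I} C"
  shows "set_ideal F (\<Union>C)"
proof -
  have C: "\<And>I. I \<in> C \<Longrightarrow> set_ideal F I" "\<And>I J. I \<in> C \<Longrightarrow> J \<in> C \<Longrightarrow> I \<subseteq> J \<or> J \<subseteq> I"
    using assms(2) by (auto simp: subset.chain_def)
  show ?thesis
    unfolding set_ideal_def
  proof (intro conjI ballI impI)
    show "\<Union>C \<subseteq> F"
      using set_idealD(1)[OF C(1)] by blast
    show "{} \<in> \<Union>C"
      using set_idealD(2)[OF C(1)] assms(1) by blast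
    show "A \<union> B \<in> \<Union>C" if AB: "A \<in> \<Union>C" "B \<in> \<Union>C" for A B
    proof -
      obtain I J where IJ: "I \<in> C" "A \<in> I" "J \<in> C" "B \<in> J"
        using AB by blast
      then obtain K where K: "K \<in> C" "A \<in> K" "B \<in> K"
        using C(2)[of I J] by blast
      then have "A \<union> B \<in> K"
        using set_idealD(3)[OF C(1)] by blast
      then show ?thesis
        using K(1) by blast
    qed
    show "B \<in> \<Union>C" if "A \<in> \<Union>C" "B \<in> F" "B \<subseteq> A" for A B
      using that set_idealD(4)[OF C(1), of _ A B] by blast
  qed
qed

text \<open>Zorn's lemma extends \<open>I\<close> to a maximal proper ideal \<open>J\<close>.
  Maximality makes \<open>J\<close> prime, and then \<open>F - J\<close> is an ultrafilter.\<close>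

lemma ultrafilter_disjoint_ideal:
  assumes "algebra X F" "set_ideal F I" "X \<notin> I"
  obtains p where "ultrafilter_in X F p" "p \<inter> I = {}"
proof -
  interpret algebra X F by fact
  let ?P = "{J. set_ideal F J \<and> I \<subseteq> J \<and> X \<notin> J}"
  have "\<exists>J\<in>?P. \<forall>K\<in>?P. J \<subseteq> K \<longrightarrow> K = J"
  proof (rule subset_Zorn_nonempty)
    show "?P \<noteq> {}"
      using assms by blast
    fix C assume C: "C \<noteq> {}" "subset.chain ?P C"
    then have "subset.chain {I. set_ideal F I} C"
      by (auto simp: subset.chain_def)
    then have "set_ideal F (\<Union>C)"
      using set_ideal_Union_chain C(1) by blast
    then show "\<Union>C \<in> ?P"
      using C by (auto simp: subset.chain_def)
  qed
  then obtain J where JP: "J \<in> ?P" and Jmax: "\<forall>K\<in>?P. J \<subseteq> K \<longrightarrow> K = J"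
    by blast
  then have J: "set_ideal F J" "I \<subseteq> J" "X \<notin> J"
    by auto
  have max: "K = J" if "set_ideal F K" "X \<notin> K" "J \<subseteq> K" for K
    using Jmax[rule_format, of K] J(2) that by blast
  note JF = set_idealD(1)[OF J(1)] and Jempty = set_idealD(2)[OF J(1)]
    and JUn = set_idealD(3)[OF J(1)] and Jdown = set_idealD(4)[OF J(1)]
  have prime: "X - A \<in> J" if A: "A \<in> F" "A \<notin> J" for A
  proof -
    \<comment> \<open>The ideal generated by \<open>J\<close> and \<open>A\<close>. It is strictly
      larger than \<open>J\<close>, so by maximality it contains \<open>X\<close>.\<close>
    let ?K = "{B \<in> F. \<exists>C\<in>J. B \<subseteq> C \<union> A}"
    have "set_ideal F ?K"
      unfolding set_ideal_def
    proof (intro conjI ballI impI)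
      show "B \<union> B' \<in> ?K" if BB: "B \<in> ?K" "B' \<in> ?K" for B B'
      proof -
        obtain C C' where "C \<in> J" "B \<subseteq> C \<union> A" "C' \<in> J" "B' \<subseteq> C' \<union> A"
          using BB by blast
        then have "C \<union> C' \<in> J" "B \<union> B' \<subseteq> (C \<union> C') \<union> A"
          using JUn by blast+
        then show ?thesis
          using BB by blast
      qed
    qed (use Jempty in auto)
    moreover have "J \<subseteq> ?K"
      using JF by blast
    moreover have "A \<in> ?K"
      using A Jempty by blast
    ultimately have "X \<in> ?K"
      using max[of ?K] A(2) by blast
    then obtain C where "C \<in> J" "X \<subseteq> C \<union> A"
      by blast
    then show ?thesis
      using A(1) by (auto intro: Jdown[OF \<open>C \<in> J\<close>])
  qed
  have "ultrafilter_in X F (F - J)"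
    unfolding ultrafilter_in_def
  proof (intro conjI ballI impI)
    show "A \<inter> B \<in> F - J" if "A \<in> F - J" "B \<in> F - J" for A B
    proof -
      have eq: "(A \<inter> B) \<union> ((X - A) \<union> (X - B)) = X"
        using that sets_into_space by blast
      have "A \<inter> B \<notin> J"
      proof
        assume "A \<inter> B \<in> J"
        moreover have "X - A \<in> J" "X - B \<in> J"
          using prime that by auto
        ultimately have "(A \<inter> B) \<union> ((X - A) \<union> (X - B)) \<in> J"
          using JUn by blast
        then show False
          using J(3) unfolding eq by blast
      qed
      then show ?thesis
        using that by auto
    qed
    show "B \<in> F - J" if "A \<in> F - J" "B \<in> F" "A \<subseteq> B" for A B
      using that Jdown by blast
    show "A \<in> F - J \<or> X - A \<in> F - J" if "A \<in> F" for A
    proof (rule ccontr)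
      assume "\<not> ?thesis"
      then have "A \<union> (X - A) \<in> J"
        using that JUn[of A "X - A"] by (simp add: Diff)
      moreover have "A \<union> (X - A) = X"
        using sets_into_space[OF that] by blast
      ultimately show False
        using J(3) by simp
    qed
  qed (use J(3) Jempty in auto)
  then show ?thesis
    using that J(2) by blast
qed

lemma ultrafilter_inD:
  assumes "ultrafilter_in X F p"
  shows "A \<in> p \<Longrightarrow> A \<in> F" "X \<in> p" "{} \<notin> p" "A \<in> p \<Longrightarrow> B \<in> p \<Longrightarrow> A \<inter> B \<in> p"
    "A \<in> p \<Longrightarrow> B \<in> F \<Longrightarrow> A \<subseteq> B \<Longrightarrow> B \<in> p" "A \<in> F \<Longrightarrow> A \<notin> p \<Longrightarrow> X - A \<in> p"
  using assms unfolding ultrafilter_in_def by (metis subsetD)+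

section \<open>The Stone map and compactness of the Stone space\<close>

context algebra
begin

lemma stone_map_empty [simp]: "stone_map \<Omega> M {} = {}"
  by (auto simp: stone_map_def dest: ultrafilter_inD(3))

lemma stone_map_mono:
  assumes "A \<subseteq> B" "B \<in> M"
  shows "stone_map \<Omega> M A \<subseteq> stone_map \<Omega> M B"
proof
  fix p assume "p \<in> stone_map \<Omega> M A"
  then have "ultrafilter_in \<Omega> M p" "A \<in> p"
    by (simp_all add: stone_map_def)
  moreover from this have "B \<in> p"
    using assms ultrafilter_inD(5) by metis
  ultimately show "p \<in> stone_map \<Omega> M B"
    by (simp add: stone_map_def)
qed

lemma stone_map_Int:
  assumes "A \<in> M" "B \<in> M"
  shows "stone_map \<Omega> M (A \<inter> B) = stone_map \<Omega> M A \<inter> stone_map \<Omega> M B"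
proof
  show "stone_map \<Omega> M A \<inter> stone_map \<Omega> M B \<subseteq> stone_map \<Omega> M (A \<inter> B)"
    by (auto simp: stone_map_def intro: ultrafilter_inD(4))
qed (use stone_map_mono[of "A \<inter> B"] assms in auto)

lemma stone_map_Compl:
  assumes "A \<in> M"
  shows "stone_map \<Omega> M (\<Omega> - A) = stone_map \<Omega> M \<Omega> - stone_map \<Omega> M A"
proof
  have "stone_map \<Omega> M (\<Omega> - A) \<inter> stone_map \<Omega> M A = {}"
    using stone_map_Int[of "\<Omega> - A" A] assms by (simp add: Diff Int_commute[of "\<Omega> - A"])
  then show "stone_map \<Omega> M (\<Omega> - A) \<subseteq> stone_map \<Omega> M \<Omega> - stone_map \<Omega> M A"
    using stone_map_mono[of "\<Omega> - A" \<Omega>] by auto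
  show "stone_map \<Omega> M \<Omega> - stone_map \<Omega> M A \<subseteq> stone_map \<Omega> M (\<Omega> - A)"
    using assms by (auto simp: stone_map_def intro: ultrafilter_inD(6))
qed

lemma stone_map_Un:
  assumes "A \<in> M" "B \<in> M"
  shows "stone_map \<Omega> M (A \<union> B) = stone_map \<Omega> M A \<union> stone_map \<Omega> M B"
proof
  have eq: "(\<Omega> - A) \<inter> (\<Omega> - B) = \<Omega> - (A \<union> B)"
    by blast
  have "stone_map \<Omega> M \<Omega> - stone_map \<Omega> M (A \<union> B)
      = (stone_map \<Omega> M \<Omega> - stone_map \<Omega> M A) \<inter> (stone_map \<Omega> M \<Omega> - stone_map \<Omega> M B)"
    using stone_map_Int[of "\<Omega> - A" "\<Omega> - B"] assms unfolding eq
    by (simp add: stone_map_Compl Diff flip: stone_map_Compl[OF Un])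
  moreover have "stone_map \<Omega> M (A \<union> B) \<subseteq> stone_map \<Omega> M \<Omega>"
    using assms sets_into_space by (intro stone_map_mono) auto
  ultimately show "stone_map \<Omega> M (A \<union> B) \<subseteq> stone_map \<Omega> M A \<union> stone_map \<Omega> M B"
    by blast
  show "stone_map \<Omega> M A \<union> stone_map \<Omega> M B \<subseteq> stone_map \<Omega> M (A \<union> B)"
    using assms by (intro Un_least stone_map_mono) auto
qed

lemma stone_map_UN:
  "finite I \<Longrightarrow> A ` I \<subseteq> M \<Longrightarrow> stone_map \<Omega> M (\<Union>i\<in>I. A i) = (\<Union>i\<in>I. stone_map \<Omega> M (A i))"
proof (induction I rule: finite_induct)
  case (insert i I)
  then have "(\<Union>i\<in>I. A i) \<in> M"
    by (intro finite_UN) auto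
  then show ?case
    using insert by (simp add: stone_map_Un)
qed simp

text \<open>Compactness in algebraic form. The sets whose trace on \<open>A\<close> has a finite
  cover from \<open>C\<close> form an ideal that contains \<open>\<Omega> - A\<close> and every
  member of \<open>C\<close>. An ultrafilter disjoint from it would be a point of
  \<open>stone_map \<Omega> M A\<close> outside the cover, so the ideal contains
  \<open>\<Omega>\<close>.\<close>

lemma stone_map_cover:
  assumes "A \<in> M" "C \<subseteq> M" "stone_map \<Omega> M A \<subseteq> (\<Union>B\<in>C. stone_map \<Omega> M B)"
  obtains C' where "C' \<subseteq> C" "finite C'" "A \<subseteq> \<Union>C'"
proof -
  define I where "I = {B \<in> M. \<exists>C'. C' \<subseteq> C \<and> finite C' \<and> B \<inter> A \<subseteq> \<Union>C'}"
  have I_intro: "B \<in> I" if "B \<in> M" "C' \<subseteq> C" "finite C'" "B \<inter> A \<subseteq> \<Union>C'" for B C'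
    unfolding I_def using that by blast
  have I_elim: "\<exists>C'. C' \<subseteq> C \<and> finite C' \<and> B \<inter> A \<subseteq> \<Union>C'" "B \<in> M" if "B \<in> I" for B
    using that unfolding I_def by simp_all
  have I: "set_ideal M I"
    unfolding set_ideal_def
  proof (intro conjI ballI impI)
    show "I \<subseteq> M"
      using I_elim(2) by (rule subsetI)
    show "{} \<in> I"
      by (rule I_intro[of _ "{}"]) simp_all
    show "B \<union> B' \<in> I" if B: "B \<in> I" and B': "B' \<in> I" for B B'
    proof -
      obtain D where D: "D \<subseteq> C" "finite D" "B \<inter> A \<subseteq> \<Union>D"
        using I_elim(1)[OF B] by (elim exE conjE)
      obtain D' where D': "D' \<subseteq> C" "finite D'" "B' \<inter> A \<subseteq> \<Union>D'"
        using I_elim(1)[OF B'] by (elim exE conjE)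
      have "(B \<union> B') \<inter> A \<subseteq> \<Union>(D \<union> D')"
        using D(3) D'(3) by blast
      then show ?thesis
        using D D' I_elim(2)[OF B] I_elim(2)[OF B'] by (intro I_intro[of _ "D \<union> D'"]) auto
    qed
    show "B \<in> I" if D: "D \<in> I" and B: "B \<in> M" "B \<subseteq> D" for B D
    proof -
      obtain C' where C': "C' \<subseteq> C" "finite C'" "D \<inter> A \<subseteq> \<Union>C'"
        using I_elim(1)[OF D] by (elim exE conjE)
      have "B \<inter> A \<subseteq> \<Union>C'"
        using C'(3) B(2) by blast
      then show ?thesis
        by (rule I_intro[OF B(1) C'(1,2)])
    qed
  qed
  have "\<Omega> \<in> I"
  proof (rule ccontr)
    assume "\<Omega> \<notin> I"
    then obtain p where p: "ultrafilter_in \<Omega> M p" "p \<inter> I = {}"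
      using ultrafilter_disjoint_ideal[OF algebra_axioms I] by metis
    have "\<Omega> - A \<in> I"
      using \<open>A \<in> M\<close> by (intro I_intro[of _ "{}"]) auto
    then have "A \<in> p"
      using p(2) ultrafilter_inD(6)[OF p(1) \<open>A \<in> M\<close>] by blast
    then have "p \<in> stone_map \<Omega> M A"
      using p(1) by (simp add: stone_map_def)
    then obtain B where B: "B \<in> C" "p \<in> stone_map \<Omega> M B"
      using assms(3) by blast
    then have "B \<in> I"
      using assms(2) by (intro I_intro[of _ "{B}"]) auto
    then show False
      using B(2) p(2) by (auto simp: stone_map_def)
  qed
  then obtain C' where "C' \<subseteq> C" "finite C'" "\<Omega> \<inter> A \<subseteq> \<Union>C'"
    using I_elim(1) by metis
  then show thesis
    using that sets_into_space[OF \<open>A \<in> M\<close>] by (simp add: Int_absorb1)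
qed

text \<open>The cover lemma for the single set \<open>B\<close> reflects inclusions; in particular
  the Stone map is injective.\<close>

lemma stone_map_subset_iff:
  assumes "A \<in> M" "B \<in> M"
  shows "stone_map \<Omega> M A \<subseteq> stone_map \<Omega> M B \<longleftrightarrow> A \<subseteq> B"
proof
  assume "stone_map \<Omega> M A \<subseteq> stone_map \<Omega> M B"
  then obtain C where "C \<subseteq> {B}" "finite C" "A \<subseteq> \<Union>C"
    using stone_map_cover[OF assms(1), of "{B}"] assms(2) by (simp, metis)
  then show "A \<subseteq> B"
    by auto
qed (use assms stone_map_mono in blast)

lemma openin_stone_map: "A \<in> M \<Longrightarrow> openin (stone_space \<Omega> M) (stone_map \<Omega> M A)"
  by (simp add: stone_space_def openin_topology_generated_by_iff generate_topology_on.Basis)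

lemma topspace_stone_space: "topspace (stone_space \<Omega> M) = stone_map \<Omega> M \<Omega>"
  using stone_map_mono[OF sets_into_space top]
  by (auto simp: stone_space_def topology_generated_by_topspace)

text \<open>The generating sets are closed under finite intersections, so they form a base.\<close>

lemma openin_stone_space_iff:
  "openin (stone_space \<Omega> M) U \<longleftrightarrow>
    (\<forall>p\<in>U. \<exists>A\<in>M. p \<in> stone_map \<Omega> M A \<and> stone_map \<Omega> M A \<subseteq> U)" (is "_ \<longleftrightarrow> ?R U")
proof
  assume "openin (stone_space \<Omega> M) U"
  then have "generate_topology_on (stone_map \<Omega> M ` M) U"
    by (simp add: stone_space_def openin_topology_generated_by_iff)
  then show "?R U"
  proof induction
    case (Int U V)
    show ?case
    proof
      fix p assume "p \<in> U \<inter> V"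
      then have "p \<in> U" "p \<in> V"
        by simp_all
      obtain A where A: "A \<in> M" "p \<in> stone_map \<Omega> M A" "stone_map \<Omega> M A \<subseteq> U"
        using Int.IH(1)[rule_format, OF \<open>p \<in> U\<close>] by (elim bexE conjE)
      obtain B where B: "B \<in> M" "p \<in> stone_map \<Omega> M B" "stone_map \<Omega> M B \<subseteq> V"
        using Int.IH(2)[rule_format, OF \<open>p \<in> V\<close>] by (elim bexE conjE)
      show "\<exists>C\<in>M. p \<in> stone_map \<Omega> M C \<and> stone_map \<Omega> M C \<subseteq> U \<inter> V"
        using A B by (intro bexI[of _ "A \<inter> B"]) (auto simp: stone_map_Int)
    qed
  next
    case (UN K)
    show ?case
    proof
      fix p assume "p \<in> \<Union>K"
      then obtain k where "k \<in> K" "p \<in> k" by blast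
      then show "\<exists>A\<in>M. p \<in> stone_map \<Omega> M A \<and> stone_map \<Omega> M A \<subseteq> \<Union>K"
        using UN.IH[OF \<open>k \<in> K\<close>, rule_format, OF \<open>p \<in> k\<close>] by (meson Union_upper subset_trans)
    qed
  qed auto
next
  assume R: "?R U"
  have "U = \<Union>{stone_map \<Omega> M A | A. A \<in> M \<and> stone_map \<Omega> M A \<subseteq> U}"
  proof
    show "U \<subseteq> \<Union>{stone_map \<Omega> M A | A. A \<in> M \<and> stone_map \<Omega> M A \<subseteq> U}"
    proof
      fix p assume "p \<in> U"
      then obtain A where "A \<in> M" "p \<in> stone_map \<Omega> M A" "stone_map \<Omega> M A \<subseteq> U"
        using R[rule_format, OF \<open>p \<in> U\<close>] by (elim bexE conjE)
      then show "p \<in> \<Union>{stone_map \<Omega> M A | A. A \<in> M \<and> stone_map \<Omega> M A \<subseteq> U}"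
        by auto
    qed
  qed auto
  moreover have "openin (stone_space \<Omega> M) (\<Union>{stone_map \<Omega> M A | A. A \<in> M \<and> stone_map \<Omega> M A \<subseteq> U})"
    by (intro openin_Union) (auto simp: openin_stone_map)
  ultimately show "openin (stone_space \<Omega> M) U"
    by simp
qed

lemma openin_stone_spaceE:
  assumes "openin (stone_space \<Omega> M) U" "p \<in> U"
  obtains A where "A \<in> M" "p \<in> stone_map \<Omega> M A" "stone_map \<Omega> M A \<subseteq> U"
  using assms(1)[unfolded openin_stone_space_iff, rule_format, OF assms(2)] by (elim bexE conjE)

text \<open>The clopen sets inside \<open>U\<close> cover \<open>U\<close> and are closed under
  finite unions, so a finite subcover of \<open>K\<close> merges into one of them.\<close>

lemma compactin_stone_cover:
  assumes K: "compactin (stone_space \<Omega> M) K" "K \<subseteq> U" "openin (stone_space \<Omega> M) U"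
  obtains A where "A \<in> M" "K \<subseteq> stone_map \<Omega> M A" "stone_map \<Omega> M A \<subseteq> U"
proof -
  let ?\<U> = "stone_map \<Omega> M ` {A \<in> M. stone_map \<Omega> M A \<subseteq> U}"
  have "K \<subseteq> \<Union>?\<U>"
  proof
    fix p assume "p \<in> K"
    then obtain A where "A \<in> M" "p \<in> stone_map \<Omega> M A" "stone_map \<Omega> M A \<subseteq> U"
      using openin_stone_spaceE[OF K(3), of p] K(2) by auto
    then show "p \<in> \<Union>?\<U>"
      by auto
  qed
  moreover have "\<forall>V\<in>?\<U>. openin (stone_space \<Omega> M) V"
    using openin_stone_map by auto
  ultimately obtain \<F> where "finite \<F>" "\<F> \<subseteq> ?\<U>" "K \<subseteq> \<Union>\<F>"
    using K(1)[unfolded compactin_def, THEN conjunct2, rule_format, of ?\<U>] by auto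
  then obtain C where C: "finite C" "C \<subseteq> {A \<in> M. stone_map \<Omega> M A \<subseteq> U}" "\<F> = stone_map \<Omega> M ` C"
    by (meson finite_subset_image)
  have "stone_map \<Omega> M (\<Union>A\<in>C. A) = (\<Union>A\<in>C. stone_map \<Omega> M A)"
    using C by (intro stone_map_UN) auto
  moreover have "(\<Union>A\<in>C. A) \<in> M"
    using C by (intro finite_UN) auto
  moreover have "(\<Union>A\<in>C. stone_map \<Omega> M A) \<subseteq> U"
    using C(2) by auto
  ultimately show ?thesis
    using that[of "\<Union>A\<in>C. A"] C(3) \<open>K \<subseteq> \<Union>\<F>\<close> by simp
qed

lemma compact_space_stone_space: "compact_space (stone_space \<Omega> M)"
  unfolding compact_space_def compactin_def
proof (intro conjI allI impI subset_refl)
  fix \<U> assume \<U>: "Ball \<U> (openin (stone_space \<Omega> M)) \<and> topspace (stone_space \<Omega> M) \<subseteq> \<Union>\<U>"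
  \<comment> \<open>Refining the open cover to clopen sets makes \<open>stone_map_cover\<close>
    applicable. Each set of the finite subcover is then enlarged to a member of
    \<open>\<U>\<close>.\<close>
  let ?C = "{A \<in> M. \<exists>U\<in>\<U>. stone_map \<Omega> M A \<subseteq> U}"
  have cover: "stone_map \<Omega> M \<Omega> \<subseteq> (\<Union>A\<in>?C. stone_map \<Omega> M A)"
  proof
    fix p assume "p \<in> stone_map \<Omega> M \<Omega>"
    then obtain U where "U \<in> \<U>" "p \<in> U"
      using \<U> by (auto simp: topspace_stone_space)
    moreover from this have "openin (stone_space \<Omega> M) U"
      using \<U> by blast
    ultimately obtain A where "A \<in> M" "p \<in> stone_map \<Omega> M A" "stone_map \<Omega> M A \<subseteq> U"
      using openin_stone_spaceE by metis
    then show "p \<in> (\<Union>A\<in>?C. stone_map \<Omega> M A)"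
      using \<open>U \<in> \<U>\<close> by auto
  qed
  have "?C \<subseteq> M"
    by auto
  obtain C' where C': "C' \<subseteq> ?C" "finite C'" "\<Omega> \<subseteq> \<Union>C'"
    by (rule stone_map_cover[OF top \<open>?C \<subseteq> M\<close> cover])
  have CM: "\<And>A. A \<in> C' \<Longrightarrow> A \<in> M"
    using C'(1) by auto
  have "\<forall>A\<in>C'. \<exists>U. U \<in> \<U> \<and> stone_map \<Omega> M A \<subseteq> U"
    using C'(1) by auto
  then obtain f where f: "\<And>A. A \<in> C' \<Longrightarrow> f A \<in> \<U>" "\<And>A. A \<in> C' \<Longrightarrow> stone_map \<Omega> M A \<subseteq> f A"
    by metis
  have "stone_map \<Omega> M \<Omega> \<subseteq> stone_map \<Omega> M (\<Union>A\<in>C'. A)"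
    using C'(2,3) CM by (intro stone_map_mono finite_UN) auto
  also have "\<dots> = (\<Union>A\<in>C'. stone_map \<Omega> M A)"
    using C'(2) CM by (intro stone_map_UN) auto
  also have "\<dots> \<subseteq> \<Union>(f ` C')"
    using f by auto
  finally show "\<exists>\<F>. finite \<F> \<and> \<F> \<subseteq> \<U> \<and> topspace (stone_space \<Omega> M) \<subseteq> \<Union>\<F>"
    using C'(2) f(1) by (intro exI[of _ "f ` C'"]) (auto simp: topspace_stone_space)
qed

text \<open>A finite subcover by clopen pieces is sorted by the index of an open set containing the
  piece, and the pieces with the same index are united.\<close>

lemma stone_map_countable_open_cover:
  fixes U :: "nat \<Rightarrow> 'a set set set"
  assumes "A \<in> M" "\<And>i. openin (stone_space \<Omega> M) (U i)" "stone_map \<Omega> M A \<subseteq> (\<Union>i. U i)"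
  obtains B n where "\<forall>i. B i \<in> M" "\<forall>i. stone_map \<Omega> M (B i) \<subseteq> U i" "A \<subseteq> (\<Union>i<n. B i)"
proof -
  let ?C = "{B \<in> M. \<exists>i. stone_map \<Omega> M B \<subseteq> U i}"
  have cover: "stone_map \<Omega> M A \<subseteq> (\<Union>B\<in>?C. stone_map \<Omega> M B)"
  proof
    fix p assume "p \<in> stone_map \<Omega> M A"
    then obtain i where "p \<in> U i"
      using assms(3) by blast
    then obtain B where "B \<in> M" "p \<in> stone_map \<Omega> M B" "stone_map \<Omega> M B \<subseteq> U i"
      using openin_stone_spaceE assms(2) by metis
    then show "p \<in> (\<Union>B\<in>?C. stone_map \<Omega> M B)"
      by auto
  qed
  have "?C \<subseteq> M"
    by auto
  obtain C' where C': "C' \<subseteq> ?C" "finite C'" "A \<subseteq> \<Union>C'"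
    by (rule stone_map_cover[OF assms(1) \<open>?C \<subseteq> M\<close> cover])
  have "\<forall>B\<in>C'. \<exists>i. stone_map \<Omega> M B \<subseteq> U i"
    using C'(1) by auto
  then obtain f where f: "\<And>B. B \<in> C' \<Longrightarrow> stone_map \<Omega> M B \<subseteq> U (f B)"
    by metis
  obtain n where n: "f ` C' \<subseteq> {..<n}"
    using finite_nat_iff_bounded C'(2) by blast
  have fin: "finite {B \<in> C'. f B = i}" "(\<lambda>B. B) ` {B \<in> C'. f B = i} \<subseteq> M" for i
    using C' by auto
  show ?thesis
  proof
    show "\<forall>i. (\<Union>B\<in>{B \<in> C'. f B = i}. B) \<in> M"
      using fin by (intro allI finite_UN) auto
    show "\<forall>i. stone_map \<Omega> M (\<Union>B\<in>{B \<in> C'. f B = i}. B) \<subseteq> U i"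
      unfolding stone_map_UN[OF fin] using f by blast
    show "A \<subseteq> (\<Union>i<n. \<Union>B\<in>{B \<in> C'. f B = i}. B)"
      using C'(3) n by blast
  qed
qed

end

section \<open>The regular Borel measure of a charge\<close>

text \<open>Meant for open \<open>U\<close>. A regular measure extending the charge must take this
  value there, since each compact subset of \<open>U\<close> fits into a clopen subset of
  \<open>U\<close>.\<close>

definition stone_content :: "'a set \<Rightarrow> 'a set set \<Rightarrow> ('a set \<Rightarrow> real) \<Rightarrow> 'a set set set \<Rightarrow> ennreal" where
  "stone_content X F \<mu> U = (SUP A\<in>{A \<in> F. stone_map X F A \<subseteq> U}. ennreal (\<mu> A))"

definition stone_outer :: "'a set \<Rightarrow> 'a set set \<Rightarrow> ('a set \<Rightarrow> real) \<Rightarrow> 'a set set set \<Rightarrow> ennreal" where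
  "stone_outer X F \<mu> E = (INF U\<in>{U. openin (stone_space X F) U \<and> E \<subseteq> U}. stone_content X F \<mu> U)"

context
  fixes X :: "'a set" and F :: "'a set set" and \<mu> :: "'a set \<Rightarrow> real"
  assumes charge: "charge X F \<mu>"
begin

interpretation algebra X F
  using charge by (rule charge_algebra)

lemma stone_content_upper: "A \<in> F \<Longrightarrow> stone_map X F A \<subseteq> U \<Longrightarrow> ennreal (\<mu> A) \<le> stone_content X F \<mu> U"
  unfolding stone_content_def by (rule SUP_upper) simp

lemma stone_content_least:
  "(\<And>A. A \<in> F \<Longrightarrow> stone_map X F A \<subseteq> U \<Longrightarrow> ennreal (\<mu> A) \<le> c) \<Longrightarrow> stone_content X F \<mu> U \<le> c"
  unfolding stone_content_def by (rule SUP_least) simp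

lemma stone_content_mono: "U \<subseteq> V \<Longrightarrow> stone_content X F \<mu> U \<le> stone_content X F \<mu> V"
  by (intro stone_content_least stone_content_upper) auto

lemma stone_content_stone_map:
  assumes "A \<in> F"
  shows "stone_content X F \<mu> (stone_map X F A) = ennreal (\<mu> A)"
proof (rule antisym)
  show "stone_content X F \<mu> (stone_map X F A) \<le> ennreal (\<mu> A)"
    using assms charge_mono[OF charge]
    by (intro stone_content_least ennreal_leI) (simp add: stone_map_subset_iff)
qed (use assms stone_content_upper in simp)

text \<open>Compactness turns a countable cover of a clopen set into a finite one, for which finite
  additivity of the charge suffices. This is the source of countable additivity on the Stone
  space.\<close>

lemma stone_content_countable_subadditive:
  assumes U: "\<And>i::nat. openin (stone_space X F) (U i)"
  shows "stone_content X F \<mu> (\<Union>i. U i) \<le> (\<Sum>i. stone_content X F \<mu> (U i))"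
proof (rule stone_content_least)
  fix A assume A: "A \<in> F" "stone_map X F A \<subseteq> (\<Union>i. U i)"
  obtain B n where B: "\<forall>i. B i \<in> F" "\<forall>i. stone_map X F (B i) \<subseteq> U i" "A \<subseteq> (\<Union>i<n. B i)"
    by (rule stone_map_countable_open_cover[OF A(1) U A(2)])
  have "\<mu> A \<le> \<mu> (\<Union>i<n. B i)"
    using A B by (intro charge_mono[OF charge] finite_UN) auto
  also have "\<dots> \<le> (\<Sum>i<n. \<mu> (B i))"
    using B by (intro charge_UN_le[OF charge]) auto
  finally have "ennreal (\<mu> A) \<le> ennreal (\<Sum>i<n. \<mu> (B i))"
    by (rule ennreal_leI)
  also have "\<dots> = (\<Sum>i<n. ennreal (\<mu> (B i)))"
    using charge_nonneg[OF charge] B(1) by simp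
  also have "\<dots> \<le> (\<Sum>i<n. stone_content X F \<mu> (U i))"
    using B by (intro sum_mono stone_content_upper) auto
  also have "\<dots> \<le> (\<Sum>i. stone_content X F \<mu> (U i))"
    by (intro sum_le_suminf) auto
  finally show "ennreal (\<mu> A) \<le> (\<Sum>i. stone_content X F \<mu> (U i))" .
qed

lemma stone_outer_lower:
  "openin (stone_space X F) U \<Longrightarrow> E \<subseteq> U \<Longrightarrow> stone_outer X F \<mu> E \<le> stone_content X F \<mu> U"
  unfolding stone_outer_def by (rule INF_lower) simp

lemma stone_outer_greatest:
  "(\<And>U. openin (stone_space X F) U \<Longrightarrow> E \<subseteq> U \<Longrightarrow> c \<le> stone_content X F \<mu> U) \<Longrightarrow>
    c \<le> stone_outer X F \<mu> E"
  unfolding stone_outer_def by (rule INF_greatest) simp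

lemma stone_outer_open: "openin (stone_space X F) U \<Longrightarrow> stone_outer X F \<mu> U = stone_content X F \<mu> U"
  by (intro antisym stone_outer_lower stone_outer_greatest stone_content_mono) auto

lemma stone_outer_mono: "D \<subseteq> E \<Longrightarrow> stone_outer X F \<mu> D \<le> stone_outer X F \<mu> E"
  by (intro stone_outer_greatest stone_outer_lower) auto

lemma stone_outer_finite:
  assumes "E \<subseteq> topspace (stone_space X F)"
  shows "stone_outer X F \<mu> E < top"
proof -
  have "stone_outer X F \<mu> E \<le> stone_content X F \<mu> (stone_map X F X)"
    using assms openin_stone_map[OF top] by (intro stone_outer_lower) (auto simp: topspace_stone_space)
  also have "\<dots> < top"
    by (simp add: stone_content_stone_map)
  finally show ?thesis .
qed

lemma stone_outer_empty: "stone_outer X F \<mu> {} = 0"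
  using stone_content_stone_map[OF empty_sets] by (simp add: stone_outer_open charge_empty[OF charge])

lemma outer_measure_space_stone_outer:
  "outer_measure_space (Pow (topspace (stone_space X F))) (stone_outer X F \<mu>)"
  unfolding outer_measure_space_def countably_subadditive_def positive_def increasing_def
proof (intro conjI ballI allI impI)
  fix E :: "nat \<Rightarrow> 'a set set set"
  assume E: "range E \<subseteq> Pow (topspace (stone_space X F))"
  show "stone_outer X F \<mu> (\<Union>i. E i) \<le> (\<Sum>i. stone_outer X F \<mu> (E i))"
  proof (rule ennreal_le_epsilon)
    fix e :: real assume "0 < e"
    \<comment> \<open>The excess of the open approximations sums to \<open>e\<close>. They exist
      because the outer measure is finite.\<close>
    have "\<exists>U. openin (stone_space X F) U \<and> E i \<subseteq> U \<and>
        stone_content X F \<mu> U \<le> stone_outer X F \<mu> (E i) + ennreal (e * (1/2)^Suc i)" for i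
    proof -
      have "stone_outer X F \<mu> (E i) \<noteq> \<infinity>"
        using stone_outer_finite[of "E i"] range_subsetD[OF E, of i] by auto
      then have "\<exists>U\<in>{U. openin (stone_space X F) U \<and> E i \<subseteq> U}.
          stone_content X F \<mu> U < stone_outer X F \<mu> (E i) + ennreal (e * (1/2)^Suc i)"
        using \<open>0 < e\<close> by (intro INF_approx_ennreal[OF _ stone_outer_def]) auto
      then show ?thesis
        by (auto intro: less_imp_le)
    qed
    then obtain U where U: "\<And>i. openin (stone_space X F) (U i)" "\<And>i. E i \<subseteq> U i"
      "\<And>i. stone_content X F \<mu> (U i) \<le> stone_outer X F \<mu> (E i) + ennreal (e * (1/2)^Suc i)"
      by metis
    have "stone_outer X F \<mu> (\<Union>i. E i) \<le> stone_content X F \<mu> (\<Union>i. U i)"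
      using U by (intro stone_outer_lower openin_Union) auto
    also have "\<dots> \<le> (\<Sum>i. stone_content X F \<mu> (U i))"
      using U(1) by (rule stone_content_countable_subadditive)
    also have "\<dots> \<le> (\<Sum>i. stone_outer X F \<mu> (E i) + ennreal (e * (1/2)^Suc i))"
      using U(3) by (intro suminf_le) auto
    also have "\<dots> = (\<Sum>i. stone_outer X F \<mu> (E i)) + (\<Sum>i. ennreal (e * (1/2)^Suc i))"
      by (intro suminf_add[symmetric]) auto
    also have "(\<Sum>i. ennreal (e * (1/2)^Suc i)) = ennreal e"
      using \<open>0 < e\<close> sums_mult[OF power_half_series, of e] by (intro suminf_ennreal_eq) simp_all
    finally show "stone_outer X F \<mu> (\<Union>i. E i) \<le> (\<Sum>i. stone_outer X F \<mu> (E i)) + ennreal e" .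
  qed
qed (simp_all add: stone_outer_empty stone_outer_mono)

text \<open>Caratheodory's criterion for \<open>U\<close>, tested on an open \<open>V\<close> around
  \<open>E\<close>: a clopen \<open>A\<close> inside \<open>V \<inter> U\<close> and a clopen
  \<open>B\<close> inside \<open>V - A\<close> are disjoint, so their charges add up to at most the
  content of \<open>V\<close>. Suprema are taken first over \<open>B\<close>, then over
  \<open>A\<close>.\<close>

lemma openin_lambda_system_stone_outer:
  assumes U: "openin (stone_space X F) U"
  shows "U \<in> lambda_system (topspace (stone_space X F)) (Pow (topspace (stone_space X F)))
    (stone_outer X F \<mu>)"
proof -
  let ?T = "topspace (stone_space X F)"
  interpret P: sigma_algebra ?T "Pow ?T"
    by (rule sigma_algebra_Pow)
  have "stone_outer X F \<mu> (E \<inter> U) + stone_outer X F \<mu> (E - U) = stone_outer X F \<mu> E" if "E \<subseteq> ?T" for E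
  proof (rule antisym)
    have "subadditive (Pow ?T) (stone_outer X F \<mu>)"
      using outer_measure_space_stone_outer P.countably_subadditive_subadditive
      unfolding outer_measure_space_def by blast
    from subadditiveD[OF this, of "E \<inter> U" "E - U"]
    show "stone_outer X F \<mu> E \<le> stone_outer X F \<mu> (E \<inter> U) + stone_outer X F \<mu> (E - U)"
      using that by (auto simp: Int_Diff_disjoint Int_Diff_Un)
    show "stone_outer X F \<mu> (E \<inter> U) + stone_outer X F \<mu> (E - U) \<le> stone_outer X F \<mu> E"
    proof (rule stone_outer_greatest)
      fix V assume V: "openin (stone_space X F) V" "E \<subseteq> V"
      have A: "ennreal (\<mu> A) + stone_outer X F \<mu> (E - U) \<le> stone_content X F \<mu> V"
        if A: "A \<in> F" "stone_map X F A \<subseteq> V \<inter> U" for A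
      proof -
        have AB: "ennreal (\<mu> A) + ennreal (\<mu> B) \<le> stone_content X F \<mu> V"
          if B: "B \<in> F" "stone_map X F B \<subseteq> V - stone_map X F A" for B
        proof -
          \<comment> \<open>Disjointness in the Stone space is pulled back to
            \<open>F\<close>.\<close>
          have "stone_map X F (A \<inter> B) \<subseteq> stone_map X F {}"
            using A B by (auto simp: stone_map_Int)
          then have "A \<inter> B = {}"
            using A(1) B(1) by (subst (asm) stone_map_subset_iff) auto
          then have "ennreal (\<mu> A) + ennreal (\<mu> B) = ennreal (\<mu> (A \<union> B))"
            using A B charge_nonneg[OF charge] by (simp add: charge_disjoint_Un[OF charge])
          also have "\<dots> \<le> stone_content X F \<mu> V"
            using A B by (intro stone_content_upper) (auto simp: stone_map_Un)
          finally show ?thesis .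
        qed
        \<comment> \<open>Removing the clopen \<open>A\<close> instead of \<open>U\<close> keeps the
          difference open, as \<open>stone_outer\<close> requires, and it still contains
          \<open>E - U\<close>.\<close>
        have eq: "V - stone_map X F A = V \<inter> stone_map X F (X - A)"
          using openin_subset[OF V(1)] A(1) by (auto simp: topspace_stone_space stone_map_Compl)
        have "openin (stone_space X F) (V - stone_map X F A)"
          unfolding eq using V(1) A(1) by (intro openin_Int openin_stone_map) auto
        then have "stone_outer X F \<mu> (E - U) \<le> stone_content X F \<mu> (V - stone_map X F A)"
          using A(2) V(2) by (intro stone_outer_lower) auto
        then have "ennreal (\<mu> A) + stone_outer X F \<mu> (E - U)
            \<le> ennreal (\<mu> A) + stone_content X F \<mu> (V - stone_map X F A)"
          by (rule add_left_mono)
        also have "\<dots> = (SUP B\<in>{B \<in> F. stone_map X F B \<subseteq> V - stone_map X F A}. ennreal (\<mu> A) + ennreal (\<mu> B))"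
          unfolding stone_content_def using stone_map_empty by (intro ennreal_SUP_add_right) blast
        also have "\<dots> \<le> stone_content X F \<mu> V"
          using AB by (intro SUP_least) auto
        finally show ?thesis .
      qed
      have "stone_outer X F \<mu> (E \<inter> U) + stone_outer X F \<mu> (E - U)
          \<le> stone_content X F \<mu> (V \<inter> U) + stone_outer X F \<mu> (E - U)"
        using U V by (intro add_right_mono stone_outer_lower openin_Int) auto
      also have "\<dots> = (SUP A\<in>{A \<in> F. stone_map X F A \<subseteq> V \<inter> U}. ennreal (\<mu> A) + stone_outer X F \<mu> (E - U))"
        unfolding stone_content_def using stone_map_empty by (intro ennreal_SUP_add_left[symmetric]) blast
      also have "\<dots> \<le> stone_content X F \<mu> V"
        using A by (intro SUP_least) auto
      finally show "stone_outer X F \<mu> (E \<inter> U) + stone_outer X F \<mu> (E - U) \<le> stone_content X F \<mu> V" .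
    qed
  qed
  then show ?thesis
    using openin_subset[OF U] by (simp add: P.lambda_system_eq)
qed

text \<open>Caratheodory's theorem gives a measure on the Borel sets, since the open sets are in the
  lambda system. Outer regularity is built into \<open>stone_outer\<close>.\<close>

lemma stone_measure_exists:
  "\<exists>N. regular_borel_measure (stone_space X F) N \<and>
    (\<forall>A\<in>F. emeasure N (stone_map X F A) = ennreal (\<mu> A))"
proof -
  let ?T = "topspace (stone_space X F)"
  let ?O = "{U. openin (stone_space X F) U}"
  let ?L = "lambda_system ?T (Pow ?T) (stone_outer X F \<mu>)"
  define N where "N = measure_of ?T ?O (stone_outer X F \<mu>)"
  have O: "?O \<subseteq> Pow ?T"
    using openin_subset by auto
  have sets_N: "sets N = sigma_sets ?T ?O" and space_N: "space N = ?T"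
    using O by (simp_all add: N_def)
  have L: "measure_space ?T ?L (stone_outer X F \<mu>)"
    using sigma_algebra.caratheodory_lemma[OF sigma_algebra_Pow outer_measure_space_stone_outer] .
  have "sigma_sets ?T ?O \<subseteq> ?L"
    using L openin_lambda_system_stone_outer
    by (intro sigma_algebra.sigma_sets_subset) (auto simp: measure_space_def)
  then have ca: "countably_additive (sets N) (stone_outer X F \<mu>)"
    using L unfolding measure_space_def countably_additive_def sets_N by blast
  have emeasure_N: "emeasure N E = stone_outer X F \<mu> E" if "E \<in> sets N" for E
    using emeasure_measure_of[OF N_def O _ ca that] by (simp add: positive_def stone_outer_empty)
  have open_N: "U \<in> sets N" if "openin (stone_space X F) U" for U
    using that by (auto simp: sets_N)
  have emeasure_open: "emeasure N U = stone_content X F \<mu> U" if "openin (stone_space X F) U" for U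
    using that by (simp add: emeasure_N open_N stone_outer_open)
  have fin: "finite_measure N"
    using stone_outer_finite[of ?T] emeasure_N[of ?T] sets.top[of N] space_N by (intro finite_measureI) auto
  have outer: "emeasure N E = (INF U\<in>{U. openin (stone_space X F) U \<and> E \<subseteq> U}. emeasure N U)"
    if "E \<in> sets N" for E
    using that by (auto simp: emeasure_N stone_outer_def emeasure_open[symmetric] intro!: INF_cong)
  have inner: "emeasure N E = (SUP K\<in>{K. compactin (stone_space X F) K \<and> K \<subseteq> E}. emeasure N K)"
    if E: "E \<in> sets N" for E
  proof (rule antisym)
    have ET: "E \<subseteq> ?T"
      using sets.sets_into_space[OF E] space_N by simp
    have TE: "?T - E \<in> sets N"
      using sets.compl_sets[OF E] space_N by simp
    \<comment> \<open>Inner regularity is outer regularity of the complement: complements of open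
      sets are compact because the space is, and finiteness of \<open>N\<close> permits the
      subtractions.\<close>
    have "emeasure N E = emeasure N ?T - emeasure N (?T - E)"
      using emeasure_compl[OF TE] finite_measure.emeasure_finite[OF fin] ET space_N
      by (simp add: double_diff)
    also have "\<dots> = emeasure N ?T - (INF U\<in>{U. openin (stone_space X F) U \<and> ?T - E \<subseteq> U}. emeasure N U)"
      using outer[OF TE] by simp
    also have "\<dots> = (SUP U\<in>{U. openin (stone_space X F) U \<and> ?T - E \<subseteq> U}. emeasure N ?T - emeasure N U)"
      by (intro ennreal_INF_const_minus[symmetric]) (use openin_topspace in blast)
    also have "\<dots> \<le> (SUP K\<in>{K. compactin (stone_space X F) K \<and> K \<subseteq> E}. emeasure N K)"
    proof (rule SUP_least)
      fix U assume "U \<in> {U. openin (stone_space X F) U \<and> ?T - E \<subseteq> U}"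
      then have U: "openin (stone_space X F) U" "?T - E \<subseteq> U"
        by auto
      have "emeasure N ?T - emeasure N U = emeasure N (?T - U)"
        using emeasure_compl[OF open_N[OF U(1)]] finite_measure.emeasure_finite[OF fin] space_N by simp
      moreover have "compactin (stone_space X F) (?T - U)"
        using U(1) compact_space_stone_space by (intro closedin_compact_space) auto
      ultimately show "emeasure N ?T - emeasure N U
          \<le> (SUP K\<in>{K. compactin (stone_space X F) K \<and> K \<subseteq> E}. emeasure N K)"
        using U(2) by (auto intro!: SUP_upper)
    qed
    finally show "emeasure N E \<le> (SUP K\<in>{K. compactin (stone_space X F) K \<and> K \<subseteq> E}. emeasure N K)" .
    show "(SUP K\<in>{K. compactin (stone_space X F) K \<and> K \<subseteq> E}. emeasure N K) \<le> emeasure N E"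
      using E by (intro SUP_least emeasure_mono) auto
  qed
  have "regular_borel_measure (stone_space X F) N"
    unfolding regular_borel_measure_def using sets_N fin outer inner by blast
  moreover have "emeasure N (stone_map X F A) = ennreal (\<mu> A)" if "A \<in> F" for A
    using that by (simp add: emeasure_open openin_stone_map stone_content_stone_map)
  ultimately show ?thesis
    by blast
qed

text \<open>Uniqueness: inner regularity determines \<open>N\<close> on open sets from its values on
  clopen sets, and outer regularity then determines it on all Borel sets.\<close>

lemma regular_borel_measure_eq_stone_outer:
  assumes N: "regular_borel_measure (stone_space X F) N"
    and \<mu>: "\<And>A. A \<in> F \<Longrightarrow> emeasure N (stone_map X F A) = ennreal (\<mu> A)" and E: "E \<in> sets N"
  shows "emeasure N E = stone_outer X F \<mu> E"
proof -
  have sets_N: "sets N = sigma_sets (topspace (stone_space X F)) {U. openin (stone_space X F) U}"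
    and outer: "\<And>E. E \<in> sets N \<Longrightarrow>
      emeasure N E = (INF U\<in>{U. openin (stone_space X F) U \<and> E \<subseteq> U}. emeasure N U)"
    and inner: "\<And>E. E \<in> sets N \<Longrightarrow>
      emeasure N E = (SUP K\<in>{K. compactin (stone_space X F) K \<and> K \<subseteq> E}. emeasure N K)"
    using N unfolding regular_borel_measure_def by blast+
  have open_N: "U \<in> sets N" if "openin (stone_space X F) U" for U
    using that by (auto simp: sets_N)
  have "emeasure N U = stone_content X F \<mu> U" if U: "openin (stone_space X F) U" for U
  proof (rule antisym)
    have "emeasure N K \<le> stone_content X F \<mu> U" if K: "compactin (stone_space X F) K" "K \<subseteq> U" for K
    proof -
      obtain A where A: "A \<in> F" "K \<subseteq> stone_map X F A" "stone_map X F A \<subseteq> U"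
        by (rule compactin_stone_cover[OF K U])
      have "emeasure N K \<le> emeasure N (stone_map X F A)"
        using A open_N openin_stone_map by (intro emeasure_mono) auto
      also have "\<dots> \<le> stone_content X F \<mu> U"
        using A \<mu> stone_content_upper by simp
      finally show ?thesis .
    qed
    then show "emeasure N U \<le> stone_content X F \<mu> U"
      unfolding inner[OF open_N[OF U]] by (intro SUP_least) auto
    show "stone_content X F \<mu> U \<le> emeasure N U"
    proof (rule stone_content_least)
      fix A assume "A \<in> F" "stone_map X F A \<subseteq> U"
      then show "ennreal (\<mu> A) \<le> emeasure N U"
        using emeasure_mono[of "stone_map X F A" U N] open_N[OF U] \<mu> by simp
    qed
  qed
  then show ?thesis
    using outer[OF E] by (auto simp: stone_outer_def intro!: INF_cong)
qed

lemma stone_measure: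
  "regular_borel_measure (stone_space X F) (stone_measure X F \<mu>)"
  "A \<in> F \<Longrightarrow> emeasure (stone_measure X F \<mu>) (stone_map X F A) = ennreal (\<mu> A)"
proof -
  let ?P = "\<lambda>N. regular_borel_measure (stone_space X F) N \<and>
    (\<forall>A\<in>F. emeasure N (stone_map X F A) = ennreal (\<mu> A))"
  have "\<exists>!N. ?P N"
  proof (rule ex_ex1I)
    show "\<exists>N. ?P N"
      by (rule stone_measure_exists)
    fix N N' assume N: "?P N" and N': "?P N'"
    show "N = N'"
    proof (rule measure_eqI)
      show eq: "sets N = sets N'"
        using N N' by (simp add: regular_borel_measure_def)
      show "emeasure N E = emeasure N' E" if "E \<in> sets N" for E
        using regular_borel_measure_eq_stone_outer[of N E] regular_borel_measure_eq_stone_outer[of N' E]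
          N N' that eq by simp
    qed
  qed
  from theI'[OF this] have "?P (stone_measure X F \<mu>)"
    unfolding stone_measure_def .
  then show "regular_borel_measure (stone_space X F) (stone_measure X F \<mu>)"
    "A \<in> F \<Longrightarrow> emeasure (stone_measure X F \<mu>) (stone_map X F A) = ennreal (\<mu> A)"
    by blast+
qed

text \<open>Clopen sets form a base, so a point has an open null neighbourhood exactly if it has a
  clopen one, that is, if it contains a null set. From here on measures are no longer
  needed.\<close>

lemma charge_support_eq: "charge_support X F \<mu> = {p. ultrafilter_in X F p \<and> (\<forall>A\<in>p. \<mu> A \<noteq> 0)}"
proof -
  let ?N = "stone_measure X F \<mu>"
  have top: "p \<in> topspace (stone_space X F) \<longleftrightarrow> ultrafilter_in X F p" for p
    using ultrafilter_inD(2) by (auto simp: topspace_stone_space stone_map_def)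
  have "(\<exists>U. openin (stone_space X F) U \<and> emeasure ?N U = 0 \<and> p \<in> U) \<longleftrightarrow> (\<exists>A\<in>p. \<mu> A = 0)"
    if p: "ultrafilter_in X F p" for p
  proof
    assume "\<exists>U. openin (stone_space X F) U \<and> emeasure ?N U = 0 \<and> p \<in> U"
    then obtain U where U: "openin (stone_space X F) U" "emeasure ?N U = 0" "p \<in> U"
      by blast
    obtain A where A: "A \<in> F" "p \<in> stone_map X F A" "stone_map X F A \<subseteq> U"
      by (rule openin_stone_spaceE[OF U(1,3)])
    have "U \<in> sets ?N"
      using stone_measure(1) U(1) by (auto simp: regular_borel_measure_def)
    then have "ennreal (\<mu> A) = 0"
      using emeasure_mono[OF A(3), of ?N] stone_measure(2)[OF A(1)] U(2) by simp
    then show "\<exists>A\<in>p. \<mu> A = 0"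
      using A(1,2) charge_nonneg[OF charge A(1)] by (auto simp: stone_map_def)
  next
    assume "\<exists>A\<in>p. \<mu> A = 0"
    then obtain A where A: "A \<in> p" "\<mu> A = 0"
      by blast
    have "A \<in> F"
      using ultrafilter_inD(1)[OF p A(1)] .
    then show "\<exists>U. openin (stone_space X F) U \<and> emeasure ?N U = 0 \<and> p \<in> U"
      using A p stone_measure(2)[OF \<open>A \<in> F\<close>] openin_stone_map[OF \<open>A \<in> F\<close>]
      by (intro exI[of _ "stone_map X F A"]) (simp add: stone_map_def)
  qed
  then show ?thesis
    unfolding charge_support_def borel_support_def by (auto simp: top)
qed

end

section \<open>Supports and their limsup\<close>

text \<open>The sets with null trace on \<open>A\<close> form a proper ideal that contains
  \<open>X - A\<close> and all null sets. An ultrafilter disjoint from it contains \<open>A\<close>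
  and no null set.\<close>

lemma charge_support_point:
  assumes charge: "charge X F \<mu>" and A: "A \<in> F" "\<mu> A \<noteq> 0"
  obtains p where "p \<in> charge_support X F \<mu>" "A \<in> p"
proof -
  interpret algebra X F
    using charge by (rule charge_algebra)
  let ?I = "{B \<in> F. \<mu> (B \<inter> A) = 0}"
  have I: "set_ideal F ?I"
    unfolding set_ideal_def
  proof (intro conjI ballI impI)
    show "B \<union> B' \<in> ?I" if "B \<in> ?I" "B' \<in> ?I" for B B'
      using that A charge_null_Un[OF charge, of "B \<inter> A" "B' \<inter> A"] by (simp add: Int_Un_distrib2 Int Un)
    show "B' \<in> ?I" if "B \<in> ?I" "B' \<in> F" "B' \<subseteq> B" for B B'
      using that A charge_null_mono[OF charge, of "B \<inter> A" "B' \<inter> A"]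
        Int_mono[OF \<open>B' \<subseteq> B\<close> subset_refl, of A] by (simp add: Int)
  qed (auto simp: charge_empty[OF charge])
  have "X \<notin> ?I"
    using A sets_into_space[OF A(1)] by (simp add: Int_absorb1)
  then obtain p where p: "ultrafilter_in X F p" "p \<inter> ?I = {}"
    by (rule ultrafilter_disjoint_ideal[OF algebra_axioms I])
  have "X - A \<in> ?I"
    using A(1) by (simp add: charge_empty[OF charge] Diff Diff_Int_distrib2)
  then have "A \<in> p"
    using p(2) ultrafilter_inD(6)[OF p(1) A(1)] by blast
  moreover have "\<mu> B \<noteq> 0" if "B \<in> p" for B
  proof
    assume "\<mu> B = 0"
    moreover have "B \<in> F"
      using ultrafilter_inD(1)[OF p(1) that] .
    ultimately have "B \<in> ?I"
      using A(1) charge_null_mono[OF charge, of B "B \<inter> A"] by (simp add: Int)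
    then show False
      using that p(2) by blast
  qed
  ultimately show ?thesis
    using that[of p] p(1) by (simp add: charge_support_eq[OF charge])
qed

text \<open>It suffices to test closures on the neighbourhoods given by members \<open>A\<close> of
  \<open>p\<close>. Such a neighbourhood meets the \<open>i\<close>-th tail union exactly if some
  \<open>\<mu>s j\<close> with \<open>j \<ge> i\<close> does not vanish on \<open>A\<close>.\<close>

lemma closed_limsup_charge_support_iff:
  assumes charges: "\<And>i. charge X F (\<mu>s i)"
  shows "p \<in> closed_limsup (stone_space X F) (\<lambda>i. charge_support X F (\<mu>s i)) \<longleftrightarrow>
    ultrafilter_in X F p \<and> (\<forall>A\<in>p. infinite {j. \<mu>s j A \<noteq> 0})"
proof -
  interpret algebra X F
    using charges by (rule charge_algebra)
  let ?C = "\<lambda>i. stone_space X F closure_of (\<Union>j\<in>{i..}. charge_support X F (\<mu>s j))"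
  have top: "p \<in> topspace (stone_space X F) \<longleftrightarrow> ultrafilter_in X F p"
    using ultrafilter_inD(2) by (auto simp: topspace_stone_space stone_map_def)
  show ?thesis
  proof (intro iffI conjI ballI)
    assume "p \<in> closed_limsup (stone_space X F) (\<lambda>i. charge_support X F (\<mu>s i))"
    then have p: "p \<in> ?C i" for i
      by (simp add: closed_limsup_def)
    from p[of 0] show u: "ultrafilter_in X F p"
      unfolding in_closure_of top by blast
    fix A assume A: "A \<in> p"
    have AF: "A \<in> F"
      using ultrafilter_inD(1)[OF u A] .
    show "infinite {j. \<mu>s j A \<noteq> 0}"
      unfolding infinite_nat_iff_unbounded_le
    proof
      fix i
      have "p \<in> stone_map X F A"
        using u A by (simp add: stone_map_def)
      then obtain q where "q \<in> (\<Union>j\<in>{i..}. charge_support X F (\<mu>s j))" "q \<in> stone_map X F A"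
        using p[of i] openin_stone_map[OF AF] unfolding in_closure_of by blast
      then obtain j where "i \<le> j" "\<mu>s j A \<noteq> 0"
        by (auto simp: charge_support_eq[OF charges] stone_map_def)
      then show "\<exists>j\<ge>i. j \<in> {j. \<mu>s j A \<noteq> 0}"
        by blast
    qed
  next
    assume p: "ultrafilter_in X F p \<and> (\<forall>A\<in>p. infinite {j. \<mu>s j A \<noteq> 0})"
    show "p \<in> closed_limsup (stone_space X F) (\<lambda>i. charge_support X F (\<mu>s i))"
      unfolding closed_limsup_def
    proof (intro INT_I)
      fix i
      have "\<exists>q\<in>(\<Union>j\<in>{i..}. charge_support X F (\<mu>s j)). q \<in> U"
        if U: "openin (stone_space X F) U" "p \<in> U" for U
      proof -
        obtain A where A: "A \<in> F" "p \<in> stone_map X F A" "stone_map X F A \<subseteq> U"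
          by (rule openin_stone_spaceE[OF U])
        then have "infinite {j. \<mu>s j A \<noteq> 0}"
          using p by (simp add: stone_map_def)
        then obtain j where j: "i \<le> j" "\<mu>s j A \<noteq> 0"
          unfolding infinite_nat_iff_unbounded_le by blast
        obtain q where q: "q \<in> charge_support X F (\<mu>s j)" "A \<in> q"
          by (rule charge_support_point[OF charges A(1) j(2)])
        then have "q \<in> stone_map X F A"
          by (simp add: charge_support_eq[OF charges] stone_map_def)
        then show ?thesis
          using A(3) q(1) j(1) by auto
      qed
      then show "p \<in> ?C i"
        using p unfolding in_closure_of top by blast
    qed
  qed
qed

text \<open>Every ultrafilter contains \<open>E\<close> or \<open>X - E\<close>; the first keeps it
  out of the limsup, the second out of the support. Conversely, if no such \<open>E\<close> exists,
  a common point is found as an ultrafilter avoiding a suitable ideal.\<close>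

lemma closed_limsup_disjoint_charge_support_iff:
  assumes charges: "\<And>i. charge X F (\<mu>s i)"
  shows "closed_limsup (stone_space X F) (\<lambda>i. charge_support X F (\<mu>s i)) \<inter> charge_support X F (\<mu>s i) = {}
    \<longleftrightarrow> (\<exists>E\<in>F. \<mu>s i (X - E) = 0 \<and> finite {j. \<mu>s j E \<noteq> 0})" (is "?L \<longleftrightarrow> ?R")
proof
  interpret algebra X F
    using charges by (rule charge_algebra)
  show ?L if ?R
  proof (rule ccontr)
    assume "\<not> ?L"
    then obtain p where "p \<in> closed_limsup (stone_space X F) (\<lambda>i. charge_support X F (\<mu>s i))"
      "p \<in> charge_support X F (\<mu>s i)"
      by blast
    then have p: "ultrafilter_in X F p" "\<forall>A\<in>p. infinite {j. \<mu>s j A \<noteq> 0}" "\<forall>A\<in>p. \<mu>s i A \<noteq> 0"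
      unfolding closed_limsup_charge_support_iff[of X F \<mu>s, OF charges] charge_support_eq[OF charges[of i]]
      by simp_all
    obtain E where E: "E \<in> F" "\<mu>s i (X - E) = 0" "finite {j. \<mu>s j E \<noteq> 0}"
      using \<open>?R\<close> by blast
    show False
      using ultrafilter_inD(6)[OF p(1) E(1)] p(2,3) E(2,3) by auto
  qed
  show ?R if ?L
  proof (rule ccontr)
    assume nR: "\<not> ?R"
    \<comment> \<open>This ideal contains the sets that are null for \<open>\<mu>s i\<close>
      (\<open>E = {}\<close>) and those charged by only finitely many \<open>\<mu>s j\<close>
      (\<open>E = A\<close>). An ultrafilter disjoint from it is thus in both the support and the
      limsup.\<close>
    define I where "I = {A \<in> F. \<exists>E\<in>F. \<mu>s i (A - E) = 0 \<and> finite {j. \<mu>s j E \<noteq> 0}}"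
    have I: "set_ideal F I"
      unfolding set_ideal_def
    proof (intro conjI ballI impI)
      show "I \<subseteq> F"
        by (simp add: I_def)
      show "{} \<in> I"
        by (auto simp: I_def charge_empty[OF charges] intro!: bexI[of _ "{}"])
      show "A \<union> B \<in> I" if "A \<in> I" "B \<in> I" for A B
      proof -
        from \<open>A \<in> I\<close> obtain E where E: "A \<in> F" "E \<in> F" "\<mu>s i (A - E) = 0" "finite {j. \<mu>s j E \<noteq> 0}"
          unfolding I_def by blast
        from \<open>B \<in> I\<close> obtain G where G: "B \<in> F" "G \<in> F" "\<mu>s i (B - G) = 0" "finite {j. \<mu>s j G \<noteq> 0}"
          unfolding I_def by blast
        have "\<mu>s i ((A - E) \<union> (B - G)) = 0"
          using E G by (intro charge_null_Un[OF charges]) auto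
        then have "\<mu>s i (A \<union> B - (E \<union> G)) = 0"
          by (rule charge_null_mono[OF charges]) (use E G in auto)
        moreover have "{j. \<mu>s j (E \<union> G) \<noteq> 0} \<subseteq> {j. \<mu>s j E \<noteq> 0} \<union> {j. \<mu>s j G \<noteq> 0}"
          using charge_null_Un[OF charges _ _ E(2) G(2)] by blast
        then have "finite {j. \<mu>s j (E \<union> G) \<noteq> 0}"
          using E(4) G(4) by (rule finite_subset[OF _ finite_UnI])
        ultimately show ?thesis
          unfolding I_def using E(1,2) G(1,2) by (intro CollectI conjI bexI[of _ "E \<union> G"]) auto
      qed
      show "B \<in> I" if "A \<in> I" "B \<in> F" "B \<subseteq> A" for A B
      proof -
        from \<open>A \<in> I\<close> obtain E where E: "A \<in> F" "E \<in> F" "\<mu>s i (A - E) = 0" "finite {j. \<mu>s j E \<noteq> 0}"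
          unfolding I_def by blast
        from E(3) have "\<mu>s i (B - E) = 0"
          by (rule charge_null_mono[OF charges]) (use E that in auto)
        then show ?thesis
          unfolding I_def using E \<open>B \<in> F\<close> by blast
      qed
    qed
    have "X \<notin> I"
      using nR by (simp add: I_def)
    then obtain p where p: "ultrafilter_in X F p" "p \<inter> I = {}"
      by (rule ultrafilter_disjoint_ideal[OF algebra_axioms I])
    have "\<mu>s i A \<noteq> 0" "infinite {j. \<mu>s j A \<noteq> 0}" if A: "A \<in> p" for A
    proof -
      have AF: "A \<in> F"
        using ultrafilter_inD(1)[OF p(1) A] .
      have nE: "\<not> (\<mu>s i (A - E) = 0 \<and> finite {j. \<mu>s j E \<noteq> 0})" if "E \<in> F" for E
        using A AF p(2) that unfolding I_def by blast
      show "\<mu>s i A \<noteq> 0"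
        using nE[of "{}"] by (simp add: charge_empty[OF charges])
      show "infinite {j. \<mu>s j A \<noteq> 0}"
        using nE[OF AF] by (simp add: charge_empty[OF charges])
    qed
    then have "p \<in> closed_limsup (stone_space X F) (\<lambda>i. charge_support X F (\<mu>s i))"
      "p \<in> charge_support X F (\<mu>s i)"
      unfolding closed_limsup_charge_support_iff[of X F \<mu>s, OF charges] charge_support_eq[OF charges[of i]]
      using p(1) by simp_all
    then show False
      using \<open>?L\<close> by blast
  qed
qed

section \<open>The equivalence, by way of carriers\<close>

theorem theorem4p3:
  fixes X :: "'a set" and F :: "'a set set"
    and \<mu>s :: "nat \<Rightarrow> 'a set \<Rightarrow> real" and \<mu> :: "'a set \<Rightarrow> real"
    and S :: "nat \<Rightarrow> 'a set set set"
  assumes "sigma_algebra X F"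
    and "\<And>i. charge X F (\<mu>s i)"
    and "\<And>i j. i \<noteq> j \<Longrightarrow> singular_charges X F (\<mu>s i) (\<mu>s j)"
    and "charge X F \<mu>"
    and "\<And>A. A \<in> F \<Longrightarrow> (\<lambda>i. \<mu>s i A) sums \<mu> A"
    and "\<And>i. S i = charge_support X F (\<mu>s i)"
  shows "additive_property F \<mu> \<longleftrightarrow>
     (\<forall>i. additive_property F (\<mu>s i)) \<and>
     (\<forall>i j. i \<noteq> j \<longrightarrow> strongly_singular_charges X F (\<mu>s i) (\<mu>s j)) \<and>
     closed_limsup (stone_space X F) S \<inter> (\<Union>i. S i) = {}"
proof -
  interpret charge_series X F \<mu>s \<mu>
    using assms(1,2,4,5) by (simp add: charge_series_def charge_series_axioms_def)
  have S: "S = (\<lambda>i. charge_support X F (\<mu>s i))"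
    using assms(6) by (simp add: fun_eq_iff)
  have "closed_limsup (stone_space X F) S \<inter> (\<Union>i. S i) = {} \<longleftrightarrow>
      (\<forall>i. closed_limsup (stone_space X F) S \<inter> S i = {})"
    by blast
  also have "\<dots> \<longleftrightarrow> (\<forall>i. \<exists>E\<in>F. \<mu>s i (X - E) = 0 \<and> finite {j. \<mu>s j E \<noteq> 0})"
    unfolding S closed_limsup_disjoint_charge_support_iff[of X F \<mu>s, OF assms(2)] by (rule refl)
  \<comment> \<open>Strong singularity and the limsup condition merge into the existence of
    carriers, which is the form that the additive property of the total yields and needs.\<close>
  finally have "(\<forall>i j. i \<noteq> j \<longrightarrow> strongly_singular_charges X F (\<mu>s i) (\<mu>s j)) \<and>
      closed_limsup (stone_space X F) S \<inter> (\<Union>i. S i) = {} \<longleftrightarrow>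
    (\<forall>i. \<exists>D\<in>F. \<mu>s i (X - D) = 0 \<and> (\<forall>j. j \<noteq> i \<longrightarrow> \<mu>s j D = 0))"
    using strongly_singular_locally_finite_iff_carrier[OF assms(2)] by simp
  moreover have "additive_property F \<mu> \<longleftrightarrow> (\<forall>i. additive_property F (\<mu>s i)) \<and>
    (\<forall>i. \<exists>D\<in>F. \<mu>s i (X - D) = 0 \<and> (\<forall>j. j \<noteq> i \<longrightarrow> \<mu>s j D = 0))" (is "_ \<longleftrightarrow> ?R")
  proof
    assume ap: "additive_property F \<mu>"
    have carrier: "\<exists>D\<in>F. \<mu>s i (X - D) = 0 \<and> (\<forall>j. j \<noteq> i \<longrightarrow> \<mu>s j D = 0)" for i
      using additive_property_imp_carrier[OF assms(3)[OF not_sym] ap, of i] by metis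
    moreover have "additive_property F (\<mu>s i)" for i
      using carrier[of i] additive_property_member[OF ap, of _ i] by metis
    ultimately show ?R
      by blast
  next
    assume R: ?R
    then obtain D where "\<And>i. D i \<in> F" "\<And>i. \<mu>s i (X - D i) = 0" "\<And>i j. j \<noteq> i \<Longrightarrow> \<mu>s j (D i) = 0"
      by metis
    then show "additive_property F \<mu>"
      using additive_property_total[of D] R by simp
  qed
  ultimately show ?thesis
    by simp
qed

end
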